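(* Let $B_1=B(C_1;R_l,R_r)$ and $B_2=B(C_2;R_l,R_r)$ be two operator balls in $[\mathfrak H]$ with equal left and right radii, and let $\mathcal H_1:=\mathfrak H\ominus\ker R_r$, $\mathcal H_2:=\mathfrak H\ominus\ker R_l$. Then: (i) their intersection $L:=B_1\cap B_2$ is nonempty if and only if one of the following (equivalent) conditions is satisfied: (a) $|((C_1-C_2)f,g)|\le 2^{-1}[(R_l^2f,f)+(R_r^2g,g)]$ for all $f,g\in\mathfrak H$; (b) $|((C_1-C_2)f,g)|\le \|R_lf\|\cdot\|R_rg\|$ for all $f,g\in\mathfrak H$; (c) $C_1-C_2=2R_lQR_r$ with a contraction $Q\in[\mathcal H_1,\mathcal H_2]$; (c') the operator $Q_0:=2^{-1}R_l^{-1}(C_1-C_2)R_r^{-1}$ is bounded and its closure $Q:=\overline{Q_0}\in[\mathcal H_1,\mathcal H_2]$ is a contraction. (ii) If any of the conditions (a), (b), (c) is satisfied, then $L$ admits the following parametrization: $$T\in L=B_1\cap B_2\iff T=T_K:=2^{-1}(C_1+C_2)+R_lKR_r\ \text{ with some } K\in[\mathcal H_1,\mathcal H_2] \text{ such that } \|K+Q\|\le1 \text{ and } \|K-Q\|\le1.$$ (iii) (With $L\neq\emptyset$, so that $Q$ is defined.) $L$ consists of one element, $L=\{2^{-1}(C_1+C_2)\}$, if and only if at least one of the following three conditions holds: (1) $R_l=0$; (2) $R_r=0$; (3) $Q$ is a maximal partial isometry.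
   Context: $\mathfrak H$ is a separable Hilbert space; $[\mathfrak H,\mathfrak K]$ denotes the bounded operators from $\mathfrak H$ to $\mathfrak K$, and $[\mathfrak H]=[\mathfrak H,\mathfrak H]$. For $C\in[\mathfrak H]$ and nonnegative selfadjoint $R_l,R_r\in[\mathfrak H]$, the operator ball $B(C;R_l,R_r)$ is the set of all $Z=C+R_lKR_r$ with $\|K\|\le1$; $C$ is its center and $R_l,R_r$ are its left and right radii. For $R\ge0$, $R^{-1}$ is the inverse of the restriction of $R$ to $(\ker R)^\perp$, defined on $\mathrm{ran}\,R$; in (c') it is understood that $Q_0$ is well defined on $\mathrm{ran}\,R_r$. Operators in $[\mathcal H_1,\mathcal H_2]$ act in products $R_lKR_r$ through $\mathrm{ran}\,R_r\subset\mathcal H_1$ and $\mathcal H_2\subset\mathfrak H$. The operator $Q$ in (ii) and (iii) is the one in (c), (c'). A maximal partial isometry $X\in[\mathcal H_1,\mathcal H_2]$ is one with $X^*X=I_{\mathcal H_1}$ or $XX^*=I_{\mathcal H_2}$.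
   Formalization: The bounds in (a), (b) are corrected to (R_r²f,f)+(R_l²g,g) and 2‖R_r f‖‖R_l g‖, since as printed they contradict (c); in (c'), "Q_0 well defined" includes that ran(C_1−C_2) lies in ran R_l and that C_1−C_2 vanishes on ker R_r. *)

theory Defs
  imports "HOL-Analysis.Analysis"
begin

section \<open>Complex Hilbert spaces\<close>

text \<open>
  The distribution only provides real inner product spaces.  The inner product is linear in its
  first argument; positive definiteness is contained in the axiom relating it to the norm.
\<close>

class complex_inner = real_normed_vector +
  fixes scaleC :: "complex \<Rightarrow> 'a \<Rightarrow> 'a" (infixr "*\<^sub>C" 75)
    and cinner :: "'a \<Rightarrow> 'a \<Rightarrow> complex"
  assumes scaleC_add_right: "c *\<^sub>C (x + y) = c *\<^sub>C x + c *\<^sub>C y"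
    and scaleC_add_left: "(c + d) *\<^sub>C x = c *\<^sub>C x + d *\<^sub>C x"
    and scaleC_scaleC: "c *\<^sub>C (d *\<^sub>C x) = (c * d) *\<^sub>C x"
    and scaleC_of_real: "complex_of_real r *\<^sub>C x = r *\<^sub>R x"
    and cinner_add_left: "cinner (x + y) z = cinner x z + cinner y z"
    and cinner_scaleC_left: "cinner (c *\<^sub>C x) y = c * cinner x y"
    and cinner_commute: "cinner y x = cnj (cinner x y)"
    and cinner_self: "cinner x x = complex_of_real ((norm x)\<^sup>2)"

class chilbert_space = complex_inner + complete_space

instantiation complex :: chilbert_space
begin

definition scaleC_complex :: "complex \<Rightarrow> complex \<Rightarrow> complex"
  where "scaleC_complex c x = c * x"

definition cinner_complex :: "complex \<Rightarrow> complex \<Rightarrow> complex"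
  where "cinner_complex x y = x * cnj y"

instance
  by standard
    (auto simp: scaleC_complex_def cinner_complex_def algebra_simps scaleR_conv_of_real
      complex_mult_cnj cmod_def)

end


section \<open>Bounded operators between subspaces\<close>

text \<open>
  \<open>bops M N\<close> is the set of bounded complex-linear operators from the subspace \<open>M\<close> to the
  subspace \<open>N\<close>.  Operators are represented by total functions whose values outside \<open>M\<close> are
  irrelevant.
\<close>

definition bops :: "'a::complex_inner set \<Rightarrow> 'b::complex_inner set \<Rightarrow> ('a \<Rightarrow> 'b) set" where
  "bops M N = {K. K ` M \<subseteq> N
      \<and> (\<forall>x\<in>M. \<forall>y\<in>M. K (x + y) = K x + K y)
      \<and> (\<forall>c. \<forall>x\<in>M. K (c *\<^sub>C x) = c *\<^sub>C K x)
      \<and> (\<exists>b. \<forall>x\<in>M. norm (K x) \<le> b * norm x)}"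

definition opnorm :: "'a::complex_inner set \<Rightarrow> ('a \<Rightarrow> 'b::complex_inner) \<Rightarrow> real" where
  "opnorm M K = (SUP x\<in>M. norm (K x) / norm x)"

lemma bops_UNIV:
  "K \<in> bops UNIV UNIV \<longleftrightarrow> bounded_linear K \<and> (\<forall>c x. K (c *\<^sub>C x) = c *\<^sub>C K x)"
proof
  assume K: "K \<in> bops UNIV UNIV"
  then obtain b where b: "\<And>x. norm (K x) \<le> b * norm x"
    by (auto simp: bops_def)
  have "bounded_linear K"
  proof (rule bounded_linear_intro)
    show "K (x + y) = K x + K y" for x y
      using K by (simp add: bops_def)
    show "K (r *\<^sub>R x) = r *\<^sub>R K x" for r x
      using K by (simp add: bops_def flip: scaleC_of_real)
    show "norm (K x) \<le> norm x * b" for x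
      using b[of x] by (simp add: mult.commute)
  qed
  with K show "bounded_linear K \<and> (\<forall>c x. K (c *\<^sub>C x) = c *\<^sub>C K x)"
    by (simp add: bops_def)
next
  assume K: "bounded_linear K \<and> (\<forall>c x. K (c *\<^sub>C x) = c *\<^sub>C K x)"
  then have "norm (K x) \<le> onorm K * norm x" for x
    by (simp add: onorm)
  with K show "K \<in> bops UNIV UNIV"
    by (auto simp: bops_def linear_add bounded_linear.linear)
qed

lemma opnorm_UNIV: "opnorm UNIV K = onorm K"
  by (simp add: opnorm_def onorm_def)

definition contractions :: "'a::complex_inner set \<Rightarrow> 'b::complex_inner set \<Rightarrow> ('a \<Rightarrow> 'b) set" where
  "contractions M N = {K \<in> bops M N. opnorm M K \<le> 1}"

definition cadjoint ::
    "'a::complex_inner set \<Rightarrow> 'b::complex_inner set \<Rightarrow> ('a \<Rightarrow> 'b) \<Rightarrow> ('b \<Rightarrow> 'a)" where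
  "cadjoint M N X =
    (SOME Y. Y \<in> bops N M \<and> (\<forall>x\<in>M. \<forall>y\<in>N. cinner (X x) y = cinner x (Y y)))"

definition maximal_partial_isometry ::
    "'a::complex_inner set \<Rightarrow> 'b::complex_inner set \<Rightarrow> ('a \<Rightarrow> 'b) \<Rightarrow> bool" where
  "maximal_partial_isometry M N X \<longleftrightarrow> X \<in> bops M N \<and>
    ((\<forall>x\<in>M. cadjoint M N X (X x) = x) \<or> (\<forall>y\<in>N. X (cadjoint M N X y) = y))"

definition nonneg_selfadjoint :: "('a::complex_inner \<Rightarrow> 'a) \<Rightarrow> bool" where
  "nonneg_selfadjoint R \<longleftrightarrow> R \<in> bops UNIV UNIV \<and>
    (\<forall>x y. cinner (R x) y = cinner x (R y)) \<and> (\<forall>x. 0 \<le> Re (cinner (R x) x))"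

definition kernel :: "('a::complex_inner \<Rightarrow> 'a) \<Rightarrow> 'a set" where
  "kernel R = {x. R x = 0}"

definition orthcomp :: "'a::complex_inner set \<Rightarrow> 'a set" where
  "orthcomp S = {x. \<forall>y\<in>S. cinner x y = 0}"

text \<open>The inverse of the restriction of \<open>R\<close> to \<open>(ker R)\<^sup>\<bottom>\<close>; meaningful on \<open>range R\<close> only.\<close>

definition pinv :: "('a::complex_inner \<Rightarrow> 'a) \<Rightarrow> 'a \<Rightarrow> 'a" where
  "pinv R = inv_into (orthcomp (kernel R)) R"


section \<open>Operator balls\<close>

definition operator_ball ::
    "('a::complex_inner \<Rightarrow> 'a) \<Rightarrow> ('a \<Rightarrow> 'a) \<Rightarrow> ('a \<Rightarrow> 'a) \<Rightarrow> ('a \<Rightarrow> 'a) set" where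
  "operator_ball C Rl Rr = {Z. \<exists>K \<in> contractions UNIV UNIV. Z = (\<lambda>x. C x + Rl (K (Rr x)))}"

text \<open>\<open>D = 2 R\<^sub>l Q R\<^sub>r\<close> with a contraction \<open>Q\<close> from \<open>(ker R\<^sub>r)\<^sup>\<bottom>\<close> to \<open>(ker R\<^sub>l)\<^sup>\<bottom>\<close>.\<close>

definition factors_through ::
    "('a::complex_inner \<Rightarrow> 'a) \<Rightarrow> ('a \<Rightarrow> 'a) \<Rightarrow> ('a \<Rightarrow> 'a) \<Rightarrow> ('a \<Rightarrow> 'a) \<Rightarrow> bool" where
  "factors_through D Rl Rr Q \<longleftrightarrow>
    Q \<in> contractions (orthcomp (kernel Rr)) (orthcomp (kernel Rl)) \<and>
    (\<forall>x. D x = 2 *\<^sub>R Rl (Q (Rr x)))"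

definition quotient0 ::
    "('a::complex_inner \<Rightarrow> 'a) \<Rightarrow> ('a \<Rightarrow> 'a) \<Rightarrow> ('a \<Rightarrow> 'a) \<Rightarrow> 'a \<Rightarrow> 'a" where
  "quotient0 D Rl Rr h = (1/2) *\<^sub>R pinv Rl (D (pinv Rr h))"

text \<open>
  \<open>2\<^sup>-\<^sup>1 R\<^sub>l\<^sup>-\<^sup>1 D R\<^sub>r\<^sup>-\<^sup>1\<close> is well defined on \<open>range Rr\<close> when \<open>R\<^sub>l\<^sup>-\<^sup>1\<close> can be applied to every \<open>D x\<close>
  and \<open>D x\<close> depends on \<open>R\<^sub>r x\<close> only.  Without the second requirement the choice \<open>R\<^sub>r = 0\<close> would be
  admitted for every \<open>D\<close> with range in that of \<open>R\<^sub>l\<close>.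
\<close>

definition quotient0_well_defined ::
    "('a::complex_inner \<Rightarrow> 'a) \<Rightarrow> ('a \<Rightarrow> 'a) \<Rightarrow> ('a \<Rightarrow> 'a) \<Rightarrow> bool" where
  "quotient0_well_defined D Rl Rr \<longleftrightarrow>
    range D \<subseteq> range Rl \<and> (\<forall>x y. Rr x = Rr y \<longrightarrow> D x = D y)"

text \<open>The closure of an operator is the operator whose graph is the closure of the given graph.\<close>

definition quotient0_closure_contraction ::
    "('a::complex_inner \<Rightarrow> 'a) \<Rightarrow> ('a \<Rightarrow> 'a) \<Rightarrow> ('a \<Rightarrow> 'a) \<Rightarrow> ('a \<Rightarrow> 'a) \<Rightarrow> bool" where
  "quotient0_closure_contraction D Rl Rr Q \<longleftrightarrow>
    quotient0_well_defined D Rl Rr \<and>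
    quotient0 D Rl Rr \<in> bops (range Rr) (orthcomp (kernel Rl)) \<and>
    (\<lambda>h. (h, Q h)) ` orthcomp (kernel Rr) =
      closure ((\<lambda>h. (h, quotient0 D Rl Rr h)) ` range Rr) \<and>
    Q \<in> contractions (orthcomp (kernel Rr)) (orthcomp (kernel Rl))"

text \<open>
  The two estimates below are those equivalent to \<open>D = 2 R\<^sub>l Q R\<^sub>r\<close>: as
  \<open>(D f, g) = 2 (Q R\<^sub>r f, R\<^sub>l g)\<close>, the right radius goes with \<open>f\<close>, the left one with \<open>g\<close>, and the
  bound for \<open>(D f, g)\<close> carries a factor 2.  With the radii interchanged, or without the factor 2,
  neither estimate is equivalent to the factorization (for the factor, take \<open>D = 2\<close> and
  \<open>R\<^sub>l = R\<^sub>r = 1\<close> on a one-dimensional space).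
\<close>

definition quadratic_estimate ::
    "('a::complex_inner \<Rightarrow> 'a) \<Rightarrow> ('a \<Rightarrow> 'a) \<Rightarrow> ('a \<Rightarrow> 'a) \<Rightarrow> bool" where
  "quadratic_estimate D Rl Rr \<longleftrightarrow>
    (\<forall>f g. cmod (cinner (D f) g) \<le>
      2 * ((1/2) * (Re (cinner (Rr (Rr f)) f) + Re (cinner (Rl (Rl g)) g))))"

definition product_estimate ::
    "('a::complex_inner \<Rightarrow> 'a) \<Rightarrow> ('a \<Rightarrow> 'a) \<Rightarrow> ('a \<Rightarrow> 'a) \<Rightarrow> bool" where
  "product_estimate D Rl Rr \<longleftrightarrow>
    (\<forall>f g. cmod (cinner (D f) g) \<le> 2 * (norm (Rr f) * norm (Rl g)))"

end

theory Submission
  imports Defs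
begin

text \<open>
  Compressing to \<open>(ker R\<^sub>l)\<^sup>\<bottom>\<close> and using that \<open>R\<^sub>l\<close> is injective there and \<open>ran R\<^sub>r\<close> is dense in
  \<open>(ker R\<^sub>r)\<^sup>\<bottom>\<close>, a common element \<open>C\<^sub>1 + R\<^sub>l K\<^sub>1 R\<^sub>r = C\<^sub>2 + R\<^sub>l K\<^sub>2 R\<^sub>r\<close> of the two balls has
  \<open>K\<^sub>2 - K\<^sub>1 = 2 Q\<close>, so that \<open>K = (K\<^sub>1 + K\<^sub>2) / 2\<close> satisfies \<open>K - Q = K\<^sub>1\<close> and \<open>K + Q = K\<^sub>2\<close>.  The
  factorization is obtained from the product estimate by applying the Riesz theorem in each variable
  of the form \<open>(R\<^sub>r f, R\<^sub>l g) \<mapsto> (D f, g) / 2\<close>.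

  The intersection is a single point iff \<open>Q\<close> is an extreme point of the unit ball.  If \<open>Q\<close> is
  neither isometric nor coisometric, choose \<open>a = (1 - Q\<^sup>*Q) x \<noteq> 0\<close> and \<open>c = (1 - QQ\<^sup>*) y \<noteq> 0\<close>; by the
  Cauchy-Schwarz inequality for the form \<open>((1 - Q\<^sup>*Q) f, g)\<close>, the operators \<open>Q \<plusminus> \<epsilon> (\<cdot>, a) c\<close> are
  contractions for small \<open>\<epsilon>\<close>, and no square roots of operators are needed.
\<close>


section \<open>Riesz representation and projections\<close>

lemma cinner_add_right: "cinner x (y + z) = cinner x y + cinner x z"
  by (metis cinner_add_left cinner_commute complex_cnj_add)

lemma cinner_scaleC_right: "cinner x (c *\<^sub>C y) = cnj c * cinner x y"
  by (metis cinner_scaleC_left cinner_commute complex_cnj_mult)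

definition csubspace :: "'a::complex_inner set \<Rightarrow> bool" where
  "csubspace S \<longleftrightarrow> 0 \<in> S \<and> (\<forall>x\<in>S. \<forall>y\<in>S. x + y \<in> S) \<and> (\<forall>c. \<forall>x\<in>S. c *\<^sub>C x \<in> S)"

text \<open>The linear part of \<open>bops\<close>, kept apart from range and bound so that
  functionals and maps whose bound is proved only later are covered.\<close>

definition clinear_on :: "'a::complex_inner set \<Rightarrow> ('a \<Rightarrow> 'b::complex_inner) \<Rightarrow> bool" where
  "clinear_on S f \<longleftrightarrow> (\<forall>x\<in>S. \<forall>y\<in>S. f (x + y) = f x + f y) \<and> (\<forall>c. \<forall>x\<in>S. f (c *\<^sub>C x) = c *\<^sub>C f x)"

lemma csubspace_UNIV [simp]: "csubspace UNIV"
  by (simp add: csubspace_def)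

lemma csubspace_scaleR: "csubspace S \<Longrightarrow> x \<in> S \<Longrightarrow> r *\<^sub>R x \<in> S"
  by (metis csubspace_def scaleC_of_real)

lemma csubspace_diff: "csubspace S \<Longrightarrow> x \<in> S \<Longrightarrow> y \<in> S \<Longrightarrow> x - y \<in> S"
  using csubspace_scaleR[of S y "-1"] by (force simp: csubspace_def)

lemma clinear_on_scaleR: "clinear_on S f \<Longrightarrow> x \<in> S \<Longrightarrow> f (r *\<^sub>R x) = r *\<^sub>R f x"
  by (metis clinear_on_def scaleC_of_real)

lemma clinear_on_diff:
  assumes "csubspace S" "clinear_on S f" "x \<in> S" "y \<in> S"
  shows "f (x - y) = f x - f y"
proof -
  have "f (x + (-1) *\<^sub>R y) = f x + f ((-1) *\<^sub>R y)"
    using assms csubspace_scaleR[OF assms(1,4)] unfolding clinear_on_def by blast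
  also have "f ((-1) *\<^sub>R y) = (-1) *\<^sub>R f y"
    using assms clinear_on_scaleR by blast
  finally show ?thesis by simp
qed

lemma clinear_on_zero:
  assumes "csubspace S" "clinear_on S f"
  shows "f 0 = 0"
  using clinear_on_scaleR[OF assms(2), of 0 0] assms(1) by (simp add: csubspace_def)

text \<open>For positive \<open>c\<close> evaluate at the minimum \<open>t = -b/c\<close>; for
  \<open>c = 0\<close> a nonzero \<open>b\<close> would allow the value -1. Besides Cauchy-Schwarz
  this serves two variational arguments: with \<open>a = 0\<close> it makes the linear coefficient
  vanish, and it turns an estimate by a sum of squares into one by a product.\<close>

lemma quadratic_nonneg_discriminant:
  fixes a b c :: real
  assumes "\<And>t. 0 \<le> a + 2 * t * b + t\<^sup>2 * c" and "0 \<le> c"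
  shows "b\<^sup>2 \<le> a * c"
proof (cases "c = 0")
  case True
  have "b = 0"
  proof (rule ccontr)
    assume "b \<noteq> 0"
    then show False
      using assms(1)[of "-(a + 1) / (2 * b)"] True by (simp add: field_simps)
  qed
  then show ?thesis using True by simp
next
  case False
  then have "c > 0" using assms(2) by simp
  then show ?thesis
    using assms(1)[of "-b / c"] by (simp add: field_simps power2_eq_square)
qed

text \<open>Covers \<open>cinner\<close> as well as the defect form of a contraction. A unimodular
  \<open>u\<close> rotates \<open>x\<close> until \<open>B x y\<close> becomes real and nonnegative;
  the values of the form at \<open>u x + t y\<close> are then a real quadratic polynomial in
  \<open>t\<close>.\<close>

lemma psd_form_cauchy_schwarz:
  fixes B :: "'a::complex_inner \<Rightarrow> 'a \<Rightarrow> complex"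
  assumes S: "csubspace S"
    and add: "\<And>x y z. x \<in> S \<Longrightarrow> y \<in> S \<Longrightarrow> z \<in> S \<Longrightarrow> B (x + y) z = B x z + B y z"
    and scale: "\<And>c x y. x \<in> S \<Longrightarrow> y \<in> S \<Longrightarrow> B (c *\<^sub>C x) y = c * B x y"
    and sym: "\<And>x y. x \<in> S \<Longrightarrow> y \<in> S \<Longrightarrow> B y x = cnj (B x y)"
    and psd: "\<And>x. x \<in> S \<Longrightarrow> 0 \<le> Re (B x x)"
    and x: "x \<in> S" and y: "y \<in> S"
  shows "(cmod (B x y))\<^sup>2 \<le> Re (B x x) * Re (B y y)"
proof -
  obtain u where u: "u * B x y = of_real (cmod (B x y))" "cmod u = 1"
  proof (cases "B x y = 0")
    case False
    let ?u = "cnj (B x y) / of_real (cmod (B x y))"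
    have "?u * B x y = of_real (cmod (B x y))"
      using False complex_norm_square[of "B x y"]
      by (simp add: field_simps power2_eq_square)
    moreover have "cmod ?u = 1" using False by (simp add: norm_divide)
    ultimately show ?thesis by (rule that)
  qed (auto intro: that[of 1])
  have uu: "u * cnj u = 1"
    using u(2) complex_norm_square[of u] by simp
  have add_right: "B x (y + z) = B x y + B x z" if "x \<in> S" "y \<in> S" "z \<in> S" for x y z
  proof -
    have "y + z \<in> S" using S that by (simp add: csubspace_def)
    then have "B x (y + z) = cnj (B (y + z) x)" using sym that(1) by blast
    also have "\<dots> = cnj (B y x) + cnj (B z x)" using add that by simp
    also have "\<dots> = B x y + B x z" using sym that by metis
    finally show ?thesis .
  qed
  have scale_right: "B x (c *\<^sub>C y) = cnj c * B x y" if "x \<in> S" "y \<in> S" for c x y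
  proof -
    have "c *\<^sub>C y \<in> S" using S that by (simp add: csubspace_def)
    then have "B x (c *\<^sub>C y) = cnj (B (c *\<^sub>C y) x)" using sym that(1) by blast
    also have "\<dots> = cnj c * cnj (B y x)" using scale that by simp
    also have "\<dots> = cnj c * B x y" using sym that by metis
    finally show ?thesis .
  qed
  have "0 \<le> Re (B x x) + 2 * t * cmod (B x y) + t\<^sup>2 * Re (B y y)" for t
  proof -
    let ?p = "u *\<^sub>C x" and ?q = "of_real t *\<^sub>C y"
    have m: "?p \<in> S" "?q \<in> S" using S x y by (auto simp: csubspace_def)
    then have "B (?p + ?q) (?p + ?q) = B ?p ?p + B ?p ?q + cnj (B ?p ?q) + B ?q ?q"
      using S sym[OF m] by (simp add: add add_right csubspace_def)
    also have "B ?p ?p = B x x"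
      using uu m x by (simp add: scale scale_right mult.assoc[symmetric] mult.commute)
    also have "B ?p ?q = of_real (t * cmod (B x y))"
      using u m x y by (simp add: scale scale_right mult.left_commute)
    also have "B ?q ?q = of_real (t\<^sup>2) * B y y"
      using m y by (simp add: scale scale_right power2_eq_square)
    finally have "Re (B (?p + ?q) (?p + ?q)) = Re (B x x) + 2 * t * cmod (B x y) + t\<^sup>2 * Re (B y y)"
      by simp
    moreover have "?p + ?q \<in> S" using m S by (simp add: csubspace_def)
    ultimately show ?thesis using psd by metis
  qed
  then show ?thesis
    by (rule quadratic_nonneg_discriminant) (use psd y in simp)
qed

lemma cinner_cauchy_schwarz: "cmod (cinner x y) \<le> norm x * norm y"
proof -
  have "(cmod (cinner x y))\<^sup>2 \<le> Re (cinner x x) * Re (cinner y y)"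
    by (rule psd_form_cauchy_schwarz[of UNIV, OF _ _ _ cinner_commute])
      (simp_all add: cinner_add_left cinner_scaleC_left cinner_self)
  then have "(cmod (cinner x y))\<^sup>2 \<le> (norm x * norm y)\<^sup>2"
    by (simp add: cinner_self power_mult_distrib)
  then show ?thesis by (rule power2_le_imp_le) simp
qed

text \<open>Real scalars do not see the conjugation in the second argument, so the sesquilinear form
  is real bilinear. This supplies its sign rules and its limits.\<close>

interpretation cinner: bounded_bilinear cinner
proof
  fix a b :: 'a and r :: real
  show "cinner (r *\<^sub>R a) b = r *\<^sub>R cinner a b"
    by (metis scaleC_of_real cinner_scaleC_left scaleR_conv_of_real)
  show "cinner a (r *\<^sub>R b) = r *\<^sub>R cinner a b"
    by (metis scaleC_of_real cinner_scaleC_right complex_cnj_complex_of_real scaleR_conv_of_real)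
  show "\<exists>K. \<forall>a b. norm (cinner a b) \<le> norm a * norm b * K"
    by (rule exI[of _ 1]) (simp add: cinner_cauchy_schwarz)
qed (simp_all add: cinner_add_left cinner_add_right)

section \<open>Norm identities derived from the inner product\<close>

lemma norm_add_sq: "(norm (x + y))\<^sup>2 = (norm x)\<^sup>2 + 2 * Re (cinner x y) + (norm y)\<^sup>2"
proof -
  have "Re (cinner (x + y) (x + y)) = Re (cinner x x) + Re (cinner x y) + Re (cinner y x) + Re (cinner y y)"
    by (simp add: cinner.add_left cinner.add_right)
  moreover have "Re (cinner y x) = Re (cinner x y)"
    by (subst cinner_commute) simp
  ultimately show ?thesis by (simp add: cinner_self)
qed

lemma norm_diff_sq: "(norm (x - y))\<^sup>2 = (norm x)\<^sup>2 - 2 * Re (cinner x y) + (norm y)\<^sup>2"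
  using norm_add_sq[of x "- y"] by (simp add: cinner.minus_right)

lemma parallelogram:
  fixes x y :: "'a::complex_inner"
  shows "(norm (x + y))\<^sup>2 + (norm (x - y))\<^sup>2 = 2 * (norm x)\<^sup>2 + 2 * (norm y)\<^sup>2"
  by (simp add: norm_add_sq norm_diff_sq)

lemma norm_scaleC: "norm (s *\<^sub>C u) = cmod s * norm u"
proof -
  have "complex_of_real ((norm (s *\<^sub>C u))\<^sup>2) = (s * cnj s) * cinner u u"
    by (simp only: cinner_self[symmetric] cinner_scaleC_left cinner_scaleC_right mult_ac)
  also have "\<dots> = complex_of_real ((cmod s * norm u)\<^sup>2)"
    by (simp add: cinner_self power_mult_distrib flip: complex_norm_square)
  finally have "(norm (s *\<^sub>C u))\<^sup>2 = (cmod s * norm u)\<^sup>2" by (simp only: of_real_eq_iff)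
  then show ?thesis by (rule power2_eq_imp_eq) simp_all
qed

text \<open>
  Minimizing \<open>\<parallel>R x\<parallel>\<^sup>2 - 2 Re (\<phi> x)\<close> makes the images \<open>R x\<close> of a minimizing sequence converge.  With
  \<open>R = id\<close> this is the usual Riesz theorem; a general \<open>R\<close> gives functionals on \<open>ran R\<close>, which
  need not be closed.
\<close>

lemma riesz_through:
  fixes R :: "'b::complex_inner \<Rightarrow> 'a::chilbert_space" and \<phi> :: "'b \<Rightarrow> complex"
  assumes S: "csubspace S" and R: "clinear_on S R" and \<phi>: "clinear_on S \<phi>"
    and bound: "\<And>x. x \<in> S \<Longrightarrow> cmod (\<phi> x) \<le> b * norm (R x)" and "0 \<le> b"
  shows "\<exists>v\<in>closure (R ` S). norm v \<le> b \<and> (\<forall>x\<in>S. \<phi> x = cinner (R x) v)"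
proof -
  define J where "J x = (norm (R x))\<^sup>2 - 2 * Re (\<phi> x)" for x
  have Sadd: "x + y \<in> S" if "x \<in> S" "y \<in> S" for x y using S that by (simp add: csubspace_def)
  have S0: "0 \<in> S" using S by (simp add: csubspace_def)
  \<comment> \<open>Completing the square: \<open>J x\<close> is at least
    \<open>(norm (R x) - b)^2 - b^2\<close>.\<close>
  have J_lower: "- b\<^sup>2 \<le> J x" if "x \<in> S" for x
  proof -
    have "Re (\<phi> x) \<le> b * norm (R x)"
      using bound[OF that] complex_Re_le_cmod order_trans by blast
    moreover have "0 \<le> (norm (R x) - b)\<^sup>2" by simp
    ultimately show ?thesis unfolding J_def power2_diff by (simp add: mult.commute)
  qed
  define m where "m = (INF x\<in>S. J x)"
  have bdd: "bdd_below (J ` S)" using J_lower by (auto simp: bdd_below_def)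
  have m_le: "m \<le> J x" if "x \<in> S" for x
    using bdd that by (simp add: m_def cINF_lower)
  have "\<exists>x\<in>S. J x < m + 1 / Suc n" for n
    using cINF_less_iff[OF _ bdd, of "m + 1 / Suc n"] S0 by (auto simp: m_def)
  then obtain X where X: "\<And>n. X n \<in> S" "\<And>n. J (X n) < m + 1 / Suc n" by metis
  have lin: "R (x + y) = R x + R y" "\<phi> (x + y) = \<phi> x + \<phi> y" if "x \<in> S" "y \<in> S" for x y
    using R \<phi> that by (auto simp: clinear_on_def)
  \<comment> \<open>The midpoint of \<open>x\<close> and \<open>y\<close> has \<open>J\<close> at
    least \<open>m\<close>; by the parallelogram law, near-minimality of \<open>J x\<close> and
    \<open>J y\<close> forces \<open>R x\<close> and \<open>R y\<close> close together.\<close>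
  have half: "(norm (R x - R y))\<^sup>2 \<le> 2 * (J x + J y) - 4 * m" if "x \<in> S" "y \<in> S" for x y
  proof -
    have "m \<le> J ((1/2) *\<^sub>R (x + y))"
      using m_le csubspace_scaleR[OF S] Sadd that by blast
    also have "\<dots> = (norm (R x + R y))\<^sup>2 / 4 - (Re (\<phi> x) + Re (\<phi> y))"
      using that by (simp add: J_def clinear_on_scaleR[OF R] clinear_on_scaleR[OF \<phi>] Sadd lin
          power_divide add_divide_distrib)
    finally show ?thesis
      using parallelogram[of "R x" "R y"] by (simp add: J_def)
  qed
  have tail: "(norm (R (X i) - R (X j)))\<^sup>2 \<le> 4 * (1 / Suc n)" if "n \<le> i" "n \<le> j" for i j n
  proof -
    have "1 / real (Suc k) \<le> 1 / Suc n" if "n \<le> k" for k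
      using that by (intro frac_le) auto
    then have "J (X k) \<le> m + 1 / Suc n" if "n \<le> k" for k
      using X(2)[of k] that by (meson add_left_mono less_imp_le order_trans)
    then show ?thesis
      using half[OF X(1) X(1), of i j] that
      by (smt (verit, ccfv_threshold))
  qed
  have "Cauchy (\<lambda>n. R (X n))"
  proof (rule metric_CauchyI)
    fix e :: real assume "0 < e"
    then obtain n where n: "4 * (1 / Suc n) < e\<^sup>2"
      using reals_Archimedean[of "e\<^sup>2 / 4"] by (auto simp: field_simps)
    have "dist (R (X i)) (R (X j)) < e" if "n \<le> i" "n \<le> j" for i j
      using tail[OF that] n \<open>0 < e\<close> power2_less_imp_less[of "norm (R (X i) - R (X j))" e]
      by (simp add: dist_norm)
    then show "\<exists>M. \<forall>i\<ge>M. \<forall>j\<ge>M. dist (R (X i)) (R (X j)) < e" by blast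
  qed
  then obtain v where v: "(\<lambda>n. R (X n)) \<longlonglongrightarrow> v"
    using Cauchy_convergent convergent_def by blast
  \<comment> \<open>Vanishing first variation: \<open>J (X n + t y)\<close> is at least
    \<open>m\<close>, and the limit in \<open>n\<close> is a nonnegative quadratic in
    \<open>t\<close> with constant term 0, so its linear coefficient is 0.\<close>
  have Re_eq: "Re (\<phi> y) = Re (cinner (R y) v)" if y: "y \<in> S" for y
  proof -
    have "0 \<le> 0 + 2 * t * (Re (cinner v (R y)) - Re (\<phi> y)) + t\<^sup>2 * (norm (R y))\<^sup>2" for t
    proof -
      have ineq: "0 \<le> 1 / Suc n + 2 * t * (Re (cinner (R (X n)) (R y)) - Re (\<phi> y)) + t\<^sup>2 * (norm (R y))\<^sup>2" for n
      proof -
        have ty: "t *\<^sub>R y \<in> S" using csubspace_scaleR[OF S y] .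
        have "m \<le> J (X n + t *\<^sub>R y)" using m_le X(1) ty Sadd by blast
        also have "\<dots> = J (X n) + 2 * t * (Re (cinner (R (X n)) (R y)) - Re (\<phi> y)) + t\<^sup>2 * (norm (R y))\<^sup>2"
          using X(1) ty y
          by (simp add: J_def lin norm_add_sq clinear_on_scaleR[OF R] clinear_on_scaleR[OF \<phi>]
              cinner.scaleR_right power_mult_distrib algebra_simps)
        finally show ?thesis using X(2)[of n] by linarith
      qed
      have "(\<lambda>n. 1 / Suc n + 2 * t * (Re (cinner (R (X n)) (R y)) - Re (\<phi> y)) + t\<^sup>2 * (norm (R y))\<^sup>2)
          \<longlonglongrightarrow> 0 + 2 * t * (Re (cinner v (R y)) - Re (\<phi> y)) + t\<^sup>2 * (norm (R y))\<^sup>2"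
        by (intro tendsto_intros cinner.tendsto v LIMSEQ_Suc[OF lim_1_over_n])
      then show ?thesis by (rule LIMSEQ_le_const) (use ineq in blast)
    qed
    then have "(Re (cinner v (R y)) - Re (\<phi> y))\<^sup>2 \<le> 0 * (norm (R y))\<^sup>2"
      by (rule quadratic_nonneg_discriminant) simp
    then show ?thesis by (simp add: cinner_commute[of v])
  qed
  \<comment> \<open>Imaginary parts are recovered from real parts at
    \<open>\<i> *\<^sub>C y\<close>.\<close>
  have eq: "\<phi> y = cinner (R y) v" if y: "y \<in> S" for y
  proof (rule complex_eqI)
    have iy: "\<i> *\<^sub>C y \<in> S" using S y by (simp add: csubspace_def)
    have "R (\<i> *\<^sub>C y) = \<i> *\<^sub>C R y" "\<phi> (\<i> *\<^sub>C y) = \<i> * \<phi> y"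
      using R \<phi> y by (auto simp: clinear_on_def scaleC_complex_def)
    with Re_eq[OF iy] show "Im (\<phi> y) = Im (cinner (R y) v)"
      by (simp add: cinner_scaleC_left)
  qed (rule Re_eq[OF y])
  have "norm v \<le> b"
  proof (cases "v = 0")
    case False
    have "(\<lambda>n. cmod (cinner (R (X n)) v)) \<longlonglongrightarrow> cmod (cinner v v)"
      by (intro tendsto_intros cinner.tendsto v)
    moreover have "(\<lambda>n. b * norm (R (X n))) \<longlonglongrightarrow> b * norm v"
      by (intro tendsto_intros v)
    moreover have "cmod (cinner (R (X n)) v) \<le> b * norm (R (X n))" for n
      using bound[OF X(1)] eq[OF X(1)] by simp
    ultimately have "cmod (cinner v v) \<le> b * norm v"
      by (intro LIMSEQ_le) auto
    then show ?thesis using False by (simp add: cinner_self power2_eq_square norm_mult)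
  qed (use \<open>0 \<le> b\<close> in simp)
  moreover have "v \<in> closure (R ` S)"
    unfolding closure_sequential using v X(1) by (intro exI[of _ "\<lambda>n. R (X n)"]) simp
  ultimately show ?thesis using eq by blast
qed

section \<open>Bounded operators, adjoints and radii\<close>

lemma bops_iff:
  "K \<in> bops M N \<longleftrightarrow> K ` M \<subseteq> N \<and> clinear_on M K \<and> (\<exists>b. \<forall>x\<in>M. norm (K x) \<le> b * norm x)"
  by (auto simp: bops_def clinear_on_def)

lemma bops_bound:
  assumes "K \<in> bops M N"
  obtains b where "0 \<le> b" "\<And>x. x \<in> M \<Longrightarrow> norm (K x) \<le> b * norm x"
proof -
  obtain b where b: "\<forall>x\<in>M. norm (K x) \<le> b * norm x"
    using assms unfolding bops_iff by blast
  have "norm (K x) \<le> \<bar>b\<bar> * norm x" if "x \<in> M" for x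
    using b that by (smt (verit) mult_right_mono norm_ge_zero)
  then show ?thesis using that[of "\<bar>b\<bar>"] by simp
qed

lemma bops_continuous_on:
  assumes "csubspace M" "K \<in> bops M N"
  shows "continuous_on M K"
proof -
  obtain b where b: "0 \<le> b" "\<And>x. x \<in> M \<Longrightarrow> norm (K x) \<le> b * norm x"
    using bops_bound[OF assms(2)] by metis
  have lin: "clinear_on M K" using assms(2) by (simp add: bops_iff)
  have "b-lipschitz_on M K"
  proof (rule lipschitz_onI)
    fix x y assume "x \<in> M" "y \<in> M"
    then show "dist (K x) (K y) \<le> b * dist x y"
      using b(2)[OF csubspace_diff[OF assms(1)], of x y] clinear_on_diff[OF assms(1) lin, of x y]
      by (simp add: dist_norm)
  qed (rule b(1))
  then show ?thesis by (rule lipschitz_on_continuous_on)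
qed

text \<open>The bound makes the quotients bounded above, so that the supremum is meaningful, and
  forces \<open>K 0 = 0\<close>. At \<open>x = 0\<close> the quotient is 0 by the convention for
  division by zero.\<close>

lemma opnorm_le_1_iff:
  assumes "csubspace M" "\<forall>x\<in>M. norm (K x) \<le> b * norm x"
  shows "opnorm M K \<le> 1 \<longleftrightarrow> (\<forall>x\<in>M. norm (K x) \<le> norm x)"
proof -
  have ne: "M \<noteq> {}" using assms(1) by (auto simp: csubspace_def)
  have quot: "norm (K x) / norm x \<le> 1 \<longleftrightarrow> norm (K x) \<le> norm x" if "x \<in> M" for x
  proof (cases "x = 0")
    case True
    with assms(2) that have "norm (K x) \<le> b * norm x" by blast
    then show ?thesis using True by simp
  qed (simp add: field_simps)
  have "norm (K x) / norm x \<le> \<bar>b\<bar>" if "x \<in> M" for x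
  proof (cases "x = 0")
    case False
    have "norm (K x) \<le> b * norm x" using assms(2) that by blast
    also have "\<dots> \<le> \<bar>b\<bar> * norm x" by (simp add: mult_right_mono)
    finally show ?thesis using False by (simp add: field_simps)
  qed simp
  then have "bdd_above ((\<lambda>x. norm (K x) / norm x) ` M)" by (auto simp: bdd_above_def)
  then show ?thesis
    unfolding opnorm_def using cSUP_le_iff[OF ne] quot by auto
qed

lemma contractions_iff:
  assumes "csubspace M"
  shows "K \<in> contractions M N \<longleftrightarrow> K ` M \<subseteq> N \<and> clinear_on M K \<and> (\<forall>x\<in>M. norm (K x) \<le> norm x)"
    (is "?l \<longleftrightarrow> ?r")
proof
  assume ?l
  then show ?r
    using opnorm_le_1_iff[OF assms] by (fastforce simp: contractions_def bops_iff)
next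
  assume r: ?r
  then have "\<forall>x\<in>M. norm (K x) \<le> 1 * norm x" by simp
  with r opnorm_le_1_iff[OF assms this] show ?l
    unfolding contractions_def bops_iff by blast
qed

section \<open>Orthogonal complements and projections\<close>

lemma csubspace_orthcomp: "csubspace (orthcomp S)"
  by (simp add: csubspace_def orthcomp_def cinner.add_left cinner_scaleC_left cinner.zero_left)

lemma closed_orthcomp: "closed (orthcomp S)"
proof -
  have "orthcomp S = (\<Inter>y\<in>S. {x. cinner x y = 0})" by (auto simp: orthcomp_def)
  moreover have "closed {x. cinner x y = 0}" for y :: 'a
    by (intro closed_Collect_eq continuous_intros
        linear_continuous_on[OF cinner.bounded_linear_left])
  ultimately show ?thesis by auto
qed

text \<open>Test with \<open>x = u - v\<close>. This is what makes Riesz representers, chosen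
  pointwise, depend linearly on their data.\<close>

lemma cinner_right_unique:
  assumes "csubspace S" "u \<in> S" "v \<in> S" "\<And>x. x \<in> S \<Longrightarrow> cinner x u = cinner x v"
  shows "u = v"
proof -
  have "cinner (u - v) (u - v) = 0"
    using assms(4)[OF csubspace_diff[OF assms(1-3)]] by (simp add: cinner.diff_right)
  then show ?thesis by (simp add: cinner_self)
qed

lemma clinear_on_cinner_left: "clinear_on S f \<Longrightarrow> clinear_on S (\<lambda>x. cinner (f x) y)"
  by (simp add: clinear_on_def cinner.add_left cinner_scaleC_left scaleC_complex_def)

text \<open>The orthogonal projection, encoded as the Riesz representer in \<open>S\<close> of
  \<open>y \<mapsto> cinner y x\<close>; it exists when \<open>S\<close> is a closed subspace of a
  Hilbert space.\<close>

definition proj :: "'a::complex_inner set \<Rightarrow> 'a \<Rightarrow> 'a" where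
  "proj S x = (SOME v. v \<in> S \<and> (\<forall>y\<in>S. cinner y x = cinner y v))"

context
  fixes S :: "'a::chilbert_space set"
  assumes S: "csubspace S" "closed S"
begin

lemma
  shows proj_in: "proj S x \<in> S"
    and cinner_proj_right: "y \<in> S \<Longrightarrow> cinner y (proj S x) = cinner y x"
proof -
  have lin: "clinear_on S (\<lambda>y. y)" by (simp add: clinear_on_def)
  have "cmod (cinner y x) \<le> norm x * norm y" for y
    using cinner_cauchy_schwarz[of y x] by (simp add: mult.commute)
  then obtain v where "v \<in> closure ((\<lambda>y. y) ` S)" "\<And>y. y \<in> S \<Longrightarrow> cinner y x = cinner y v"
    using riesz_through[OF S(1) lin clinear_on_cinner_left[OF lin, of x], of "norm x"]
    by auto
  then have "\<exists>v. v \<in> S \<and> (\<forall>y\<in>S. cinner y x = cinner y v)"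
    using S(2) by auto
  from someI_ex[OF this] show "proj S x \<in> S" "y \<in> S \<Longrightarrow> cinner y (proj S x) = cinner y x"
    by (auto simp: proj_def)
qed

lemma proj_unique: "v \<in> S \<Longrightarrow> (\<And>y. y \<in> S \<Longrightarrow> cinner y v = cinner y x) \<Longrightarrow> proj S x = v"
  using cinner_right_unique[OF S(1)] proj_in cinner_proj_right by metis

lemma proj_ident: "x \<in> S \<Longrightarrow> proj S x = x"
  by (rule proj_unique) auto

lemma clinear_on_proj: "clinear_on T (proj S)"
proof -
  have "proj S (x + y) = proj S x + proj S y" for x y
    by (rule proj_unique) (use S proj_in cinner_proj_right in \<open>auto simp: csubspace_def cinner.add_right\<close>)
  moreover have "proj S (c *\<^sub>C x) = c *\<^sub>C proj S x" for c x
    by (rule proj_unique) (use S proj_in cinner_proj_right in \<open>auto simp: csubspace_def cinner_scaleC_right\<close>)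
  ultimately show ?thesis by (simp add: clinear_on_def)
qed

lemma norm_proj_le: "norm (proj S x) \<le> norm x"
proof (cases "proj S x = 0")
  case False
  have "cinner (proj S x) (proj S x) = cinner (proj S x) x"
    by (simp add: cinner_proj_right proj_in)
  then have "norm (proj S x) * norm (proj S x) \<le> norm (proj S x) * norm x"
    using cinner_cauchy_schwarz[of "proj S x" x]
    by (metis cinner_self norm_of_real abs_power2 power2_eq_square of_real_power)
  then show ?thesis using False by simp
qed simp

end

text \<open>Since \<open>cadjoint\<close> is a choice, existence has to be shown. For each
  \<open>y\<close> the Riesz theorem on \<open>M\<close> represents
  \<open>x \<mapsto> cinner (X x) y\<close>; closedness puts the representer into \<open>M\<close>,
  and its uniqueness there makes it linear in \<open>y\<close>.\<close>

lemma
  fixes M :: "'a::chilbert_space set" and N :: "'b::complex_inner set"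
  assumes M: "csubspace M" "closed M" and N: "csubspace N" and X: "X \<in> bops M N"
  shows cadjoint_bops: "cadjoint M N X \<in> bops N M"
    and cadjoint_cinner: "x \<in> M \<Longrightarrow> y \<in> N \<Longrightarrow> cinner x (cadjoint M N X y) = cinner (X x) y"
proof -
  obtain b where b: "0 \<le> b" "\<And>x. x \<in> M \<Longrightarrow> norm (X x) \<le> b * norm x"
    using bops_bound[OF X] by metis
  have lin: "clinear_on M X" using X by (simp add: bops_iff)
  have id: "clinear_on M (\<lambda>x. x)" by (simp add: clinear_on_def)
  have "\<exists>v. v \<in> M \<and> norm v \<le> b * norm y \<and> (\<forall>x\<in>M. cinner (X x) y = cinner x v)" for y
  proof -
    have "cmod (cinner (X x) y) \<le> b * norm y * norm x" if "x \<in> M" for x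
      using order_trans[OF cinner_cauchy_schwarz mult_right_mono[OF b(2)[OF that] norm_ge_zero]]
      by (simp add: mult_ac)
    from riesz_through[OF M(1) id clinear_on_cinner_left[OF lin, of y] this] M(2) b(1)
    show ?thesis by auto
  qed
  then obtain Y where Y: "\<And>y. Y y \<in> M" "\<And>y. norm (Y y) \<le> b * norm y"
    "\<And>x y. x \<in> M \<Longrightarrow> cinner (X x) y = cinner x (Y y)" by metis
  have "Y (y + z) = Y y + Y z" for y z
    by (rule cinner_right_unique[OF M(1)])
      (use M(1) Y in \<open>auto simp: csubspace_def cinner.add_right simp flip: Y(3)\<close>)
  moreover have "Y (c *\<^sub>C y) = c *\<^sub>C Y y" for c y
    by (rule cinner_right_unique[OF M(1)])
      (use M(1) Y in \<open>auto simp: csubspace_def cinner_scaleC_right simp flip: Y(3)\<close>)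
  moreover have "\<exists>b. \<forall>y\<in>N. norm (Y y) \<le> b * norm y" using Y(2) by blast
  ultimately have "Y \<in> bops N M"
    using Y(1) by (auto simp: bops_def)
  with Y have "\<exists>Y. Y \<in> bops N M \<and> (\<forall>x\<in>M. \<forall>y\<in>N. cinner (X x) y = cinner x (Y y))"
    by blast
  from someI_ex[OF this] show "cadjoint M N X \<in> bops N M"
    "x \<in> M \<Longrightarrow> y \<in> N \<Longrightarrow> cinner x (cadjoint M N X y) = cinner (X x) y"
    by (auto simp: cadjoint_def)
qed

lemma bops_add:
  assumes "csubspace N" "K \<in> bops M N" "Q \<in> bops M N"
  shows "(\<lambda>x. K x + Q x) \<in> bops M N"
proof -
  obtain b where b: "\<And>x. x \<in> M \<Longrightarrow> norm (K x) \<le> b * norm x"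
    using bops_bound[OF assms(2)] by metis
  obtain c where c: "\<And>x. x \<in> M \<Longrightarrow> norm (Q x) \<le> c * norm x"
    using bops_bound[OF assms(3)] by metis
  have "norm (K x + Q x) \<le> (b + c) * norm x" if "x \<in> M" for x
    using b[OF that] c[OF that] norm_triangle_ineq[of "K x" "Q x"]
    by (simp add: distrib_right)
  then have "\<exists>b. \<forall>x\<in>M. norm (K x + Q x) \<le> b * norm x" by blast
  with assms show ?thesis
    by (auto simp: bops_def csubspace_def scaleC_add_right image_subset_iff)
qed

lemma bops_scaleR:
  fixes N :: "'b::complex_inner set"
  assumes "csubspace N" "K \<in> bops M N"
  shows "(\<lambda>x. r *\<^sub>R K x) \<in> bops M N"
proof -
  obtain b where b: "\<And>x. x \<in> M \<Longrightarrow> norm (K x) \<le> b * norm x"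
    using bops_bound[OF assms(2)] by metis
  have "norm (r *\<^sub>R K x) \<le> (\<bar>r\<bar> * b) * norm x" if "x \<in> M" for x
    using mult_left_mono[OF b[OF that], of "\<bar>r\<bar>"] by (simp add: mult.assoc)
  then have "\<exists>b. \<forall>x\<in>M. norm (r *\<^sub>R K x) \<le> b * norm x" by blast
  moreover have "r *\<^sub>R c *\<^sub>C x = c *\<^sub>C r *\<^sub>R x" for c and x :: 'b
    by (metis scaleC_of_real scaleC_scaleC mult.commute)
  ultimately show ?thesis using assms csubspace_scaleR[OF assms(1)]
    by (auto simp: bops_def scaleR_add_right image_subset_iff)
qed

lemma bops_diff:
  assumes "csubspace N" "K \<in> bops M N" "Q \<in> bops M N"
  shows "(\<lambda>x. K x - Q x) \<in> bops M N"
  using bops_add[OF assms(1,2) bops_scaleR[OF assms(1,3), of "-1"]] by simp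

lemma bops_opnorm_le_1_iff:
  assumes "csubspace M" "K \<in> bops M N"
  shows "opnorm M K \<le> 1 \<longleftrightarrow> (\<forall>x\<in>M. norm (K x) \<le> norm x)"
proof -
  obtain b where "\<forall>x\<in>M. norm (K x) \<le> b * norm x"
    using assms(2) by (auto simp: bops_iff)
  with opnorm_le_1_iff assms(1) show ?thesis by blast
qed

section \<open>Nonnegative selfadjoint radii, their ranges and inverses\<close>

context
  fixes R :: "'a::chilbert_space \<Rightarrow> 'a"
  assumes R: "nonneg_selfadjoint R"
begin

lemma radius_clinear: "clinear_on UNIV R"
  and radius_selfadjoint: "cinner (R x) y = cinner x (R y)"
  using R by (auto simp: nonneg_selfadjoint_def bops_iff)

lemma radius_add: "R (x + y) = R x + R y" and radius_scaleC: "R (c *\<^sub>C x) = c *\<^sub>C R x"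
  and radius_scaleR: "R (r *\<^sub>R x) = r *\<^sub>R R x"
  and radius_diff: "R (x - y) = R x - R y"
  using radius_clinear clinear_on_scaleR[OF radius_clinear]
    clinear_on_diff[OF _ radius_clinear] by (auto simp: clinear_on_def)

lemma radius_in: "R x \<in> orthcomp (kernel R)"
  by (simp add: orthcomp_def kernel_def radius_selfadjoint cinner.zero_right)

text \<open>Take \<open>x = R z\<close>: selfadjointness turns the inner product into
  \<open>norm (R z) ^ 2\<close>.\<close>

lemma radius_orthogonal: "(\<And>x. cinner (R x) z = 0) \<Longrightarrow> R z = 0"
  using radius_selfadjoint[of "R z" z] cinner_self[of "R z"] by simp

lemma radius_inj: 
  assumes "x \<in> orthcomp (kernel R)" "y \<in> orthcomp (kernel R)" "R x = R y"
  shows "x = y"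
proof -
  have "x - y \<in> kernel R" using assms by (simp add: kernel_def radius_diff)
  moreover have "x - y \<in> orthcomp (kernel R)"
    using csubspace_diff[OF csubspace_orthcomp] assms by blast
  ultimately have "cinner (x - y) (x - y) = 0" by (simp add: orthcomp_def)
  then show ?thesis by (simp add: cinner_self)
qed

text \<open>The removed component is orthogonal to the complement of the kernel, hence to the range
  of \<open>R\<close>, and so \<open>R\<close> annihilates it.\<close>

lemma radius_proj: "R (proj (orthcomp (kernel R)) x) = R x"
proof -
  have "R (x - proj (orthcomp (kernel R)) x) = 0"
    by (rule radius_orthogonal)
      (simp add: cinner.diff_right cinner_proj_right csubspace_orthcomp closed_orthcomp radius_in)
  then show ?thesis by (simp add: radius_diff)
qed

text \<open>For the inclusion from right to left, the Riesz theorem through \<open>R\<close>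
  represents \<open>y \<mapsto> cinner (R y) x\<close> by some \<open>v\<close> in the closure of
  the range. Then \<open>R (x - v) = 0\<close>, and injectivity of \<open>R\<close> on the
  complement of its kernel gives \<open>x = v\<close>.\<close>

lemma closure_range_radius: "closure (range R) = orthcomp (kernel R)"
proof
  show "closure (range R) \<subseteq> orthcomp (kernel R)"
    by (rule closure_minimal) (auto simp: radius_in closed_orthcomp)
  show "orthcomp (kernel R) \<subseteq> closure (range R)"
  proof
    fix x assume x: "x \<in> orthcomp (kernel R)"
    have "cmod (cinner (R y) x) \<le> norm x * norm (R y)" for y
      using cinner_cauchy_schwarz[of "R y" x] by (simp add: mult.commute)
    with riesz_through[OF csubspace_UNIV radius_clinear
        clinear_on_cinner_left[OF radius_clinear, of x], of "norm x"]
    obtain v where v: "v \<in> closure (range R)" "\<And>y. cinner (R y) x = cinner (R y) v"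
      by auto
    have "R (x - v) = 0"
      by (rule radius_orthogonal) (simp add: cinner.diff_right v)
    moreover have "v \<in> orthcomp (kernel R)"
      using v(1) \<open>closure (range R) \<subseteq> orthcomp (kernel R)\<close> by blast
    ultimately have "x = v" using radius_inj x by (simp add: radius_diff)
    with v show "x \<in> closure (range R)" by simp
  qed
qed

lemma
  assumes "h \<in> range R"
  shows radius_pinv_cancel: "R (pinv R h) = h" and pinv_in: "pinv R h \<in> orthcomp (kernel R)"
proof -
  have "h \<in> R ` orthcomp (kernel R)"
    using assms radius_proj proj_in[OF csubspace_orthcomp closed_orthcomp]
    by (metis (no_types, lifting) image_iff)
  then show "R (pinv R h) = h" "pinv R h \<in> orthcomp (kernel R)"
    unfolding pinv_def by (auto intro: f_inv_into_f inv_into_into)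
qed

lemma pinv_radius: "u \<in> orthcomp (kernel R) \<Longrightarrow> pinv R (R u) = u"
  by (rule radius_inj) (auto simp: radius_pinv_cancel pinv_in)

lemma csubspace_range_radius: "csubspace (range R)"
proof -
  have "R 0 = 0" using clinear_on_zero[OF csubspace_UNIV radius_clinear] .
  then have "0 \<in> range R" by (metis rangeI)
  moreover have "R x + R y \<in> range R" "c *\<^sub>C R x \<in> range R" for x y c
    by (metis radius_add rangeI, metis radius_scaleC rangeI)
  ultimately show ?thesis by (auto simp: csubspace_def)
qed

end

section \<open>Factorizations\<close>

text \<open>On \<open>range Rr\<close> the operator \<open>quotient0\<close> agrees with
  \<open>Q\<close>. As \<open>range Rr\<close> is dense in the closed space on which
  \<open>Q\<close> is continuous, the graph of \<open>Q\<close> is the closure of the graph of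
  \<open>quotient0\<close>. Conversely, a graph has a single value over each point, so
  \<open>Q\<close> extends \<open>quotient0\<close>, and both inverses cancel.\<close>

lemma factors_through_iff_closure:
  fixes Rl Rr :: "'a::chilbert_space \<Rightarrow> 'a"
  assumes Rl: "nonneg_selfadjoint Rl" and Rr: "nonneg_selfadjoint Rr"
  shows "factors_through D Rl Rr Q \<longleftrightarrow> quotient0_closure_contraction D Rl Rr Q"
proof
  let ?H1 = "orthcomp (kernel Rr)" and ?H2 = "orthcomp (kernel Rl)"
  assume F: "factors_through D Rl Rr Q"
  have Q: "Q ` ?H1 \<subseteq> ?H2" "clinear_on ?H1 Q" "\<And>x. x \<in> ?H1 \<Longrightarrow> norm (Q x) \<le> norm x"
    and D: "\<And>x. D x = 2 *\<^sub>R Rl (Q (Rr x))"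
    using F by (auto simp: factors_through_def contractions_iff csubspace_orthcomp)
  have q: "quotient0 D Rl Rr h = Q h" if h: "h \<in> range Rr" for h
  proof -
    have "h \<in> ?H1" using h radius_in[OF Rr] by blast
    then have 2: "2 *\<^sub>R Q h \<in> ?H2"
      using Q(1) csubspace_scaleR[OF csubspace_orthcomp] by blast
    have "D (pinv Rr h) = Rl (2 *\<^sub>R Q h)"
      by (simp add: D radius_pinv_cancel[OF Rr h] radius_scaleR[OF Rl])
    then show ?thesis using pinv_radius[OF Rl 2] by (simp add: quotient0_def)
  qed
  have "D x \<in> range Rl" for x
    unfolding D by (metis radius_scaleR[OF Rl] rangeI)
  then have wd: "quotient0_well_defined D Rl Rr"
    by (auto simp: quotient0_well_defined_def D)
  have sub: "range Rr \<subseteq> ?H1" using radius_in[OF Rr] by blast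
  have "clinear_on (range Rr) (quotient0 D Rl Rr)"
    using Q(2) sub csubspace_range_radius[OF Rr]
    unfolding clinear_on_def csubspace_def by (simp add: q subset_iff)
  then have "quotient0 D Rl Rr \<in> contractions (range Rr) ?H2"
    using Q sub by (auto simp: contractions_iff csubspace_range_radius[OF Rr] q image_subset_iff subset_iff)
  then have b: "quotient0 D Rl Rr \<in> bops (range Rr) ?H2"
    by (simp add: contractions_def)
  let ?g = "\<lambda>h. (h, Q h)"
  have "continuous_on ?H1 Q"
    using F by (intro bops_continuous_on[OF csubspace_orthcomp, of Q _ ?H2])
      (simp add: factors_through_def contractions_def)
  then have cont: "continuous_on ?H1 ?g"
    by (intro continuous_intros)
  have "closed (?g ` ?H1)"
    by (rule continuous_closed_graph[OF closed_orthcomp \<open>continuous_on ?H1 Q\<close>])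
  then have "closure (?g ` range Rr) \<subseteq> ?g ` ?H1"
    using sub by (intro closure_minimal) auto
  moreover have "?g ` closure (range Rr) \<subseteq> closure (?g ` range Rr)"
    using cont by (intro image_closure_subset closed_closure closure_subset)
      (simp add: closure_range_radius[OF Rr])
  moreover have "?g ` range Rr = (\<lambda>h. (h, quotient0 D Rl Rr h)) ` range Rr"
    by (rule image_cong) (auto simp: q)
  ultimately have "?g ` ?H1 = closure ((\<lambda>h. (h, quotient0 D Rl Rr h)) ` range Rr)"
    using closure_range_radius[OF Rr] by auto
  with wd b F show "quotient0_closure_contraction D Rl Rr Q"
    by (simp add: quotient0_closure_contraction_def factors_through_def)
next
  assume F: "quotient0_closure_contraction D Rl Rr Q"
  have "quotient0 D Rl Rr h = Q h" if "h \<in> range Rr" for h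
  proof -
    have "(h, quotient0 D Rl Rr h) \<in> closure ((\<lambda>h. (h, quotient0 D Rl Rr h)) ` range Rr)"
      by (rule closure_subset[THEN subsetD], rule imageI, rule that)
    then have "(h, quotient0 D Rl Rr h) \<in> (\<lambda>h. (h, Q h)) ` orthcomp (kernel Rr)"
      using F by (simp add: quotient0_closure_contraction_def)
    then show ?thesis by auto
  qed
  \<comment> \<open>The vectors \<open>pinv Rr (Rr x)\<close> and \<open>x\<close> may differ by an
    element of the kernel; well-definedness says that \<open>D\<close> takes the same value at
    both.\<close>
  moreover have "2 *\<^sub>R Rl (quotient0 D Rl Rr (Rr x)) = D x" for x
  proof -
    have "quotient0_well_defined D Rl Rr"
      using F unfolding quotient0_closure_contraction_def by (rule conjunct1)
    then have wd: "range D \<subseteq> range Rl" "\<And>x y. Rr x = Rr y \<Longrightarrow> D x = D y"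
      unfolding quotient0_well_defined_def by blast+
    have "D (pinv Rr (Rr x)) = D x"
      by (rule wd(2)) (simp add: radius_pinv_cancel[OF Rr])
    moreover have "Rl (pinv Rl (D x)) = D x"
      using wd(1) by (intro radius_pinv_cancel[OF Rl]) blast
    ultimately show ?thesis
      by (simp add: quotient0_def radius_scaleR[OF Rl])
  qed
  ultimately show "factors_through D Rl Rr Q"
    using F by (simp add: factors_through_def quotient0_closure_contraction_def)
qed

text \<open>The vector \<open>v f\<close>, representing half of the form in \<open>g\<close> through
  \<open>Rl\<close>, plays the role of \<open>Q (Rr f)\<close>. The vector \<open>w g\<close>,
  representing \<open>f \<mapsto> cinner (v f) g\<close> through \<open>Rr\<close>, is the adjoint
  of \<open>Q\<close> at \<open>g\<close> for \<open>g\<close> in \<open>?H2\<close>. Defining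
  \<open>Q\<close> as the adjoint of \<open>w\<close> avoids extending an operator from
  \<open>range Rr\<close> by continuity.\<close>

lemma product_estimate_imp_factors_through:
  fixes Rl Rr :: "'a::chilbert_space \<Rightarrow> 'a"
  assumes Rl: "nonneg_selfadjoint Rl" and Rr: "nonneg_selfadjoint Rr"
    and D: "clinear_on UNIV D" and est: "product_estimate D Rl Rr"
  shows "\<exists>Q. factors_through D Rl Rr Q"
proof -
  let ?H1 = "orthcomp (kernel Rr)" and ?H2 = "orthcomp (kernel Rl)"
  note H1 = csubspace_orthcomp[of "kernel Rr"] closed_orthcomp[of "kernel Rr"]
  note H2 = csubspace_orthcomp[of "kernel Rl"]
  note Rl_lin = radius_clinear[OF Rl] and Rr_lin = radius_clinear[OF Rr]
  have D_lin: "D (x + y) = D x + D y" "D (c *\<^sub>C x) = c *\<^sub>C D x" for x y c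
    using D by (auto simp: clinear_on_def)
  \<comment> \<open>The inner product is taken in this order because the represented functional has
    to be linear in \<open>g\<close>.\<close>
  have "\<exists>v\<in>?H2. norm v \<le> norm (Rr f) \<and> (\<forall>g. cinner g ((1/2) *\<^sub>R D f) = cinner (Rl g) v)" for f
  proof -
    have "clinear_on UNIV (\<lambda>g::'a. g)" by (simp add: clinear_on_def)
    moreover have "cmod (cinner g ((1/2) *\<^sub>R D f)) \<le> norm (Rr f) * norm (Rl g)" for g
    proof -
      have "cmod (cinner g (D f)) = cmod (cinner (D f) g)"
        by (subst cinner_commute) simp
      also have "\<dots> \<le> 2 * (norm (Rr f) * norm (Rl g))"
        using est by (simp add: product_estimate_def)
      finally show ?thesis by (simp add: cinner.scaleR_right)
    qed
    ultimately show ?thesis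
      using riesz_through[OF csubspace_UNIV Rl_lin clinear_on_cinner_left, of "\<lambda>g. g" "(1/2) *\<^sub>R D f" "norm (Rr f)"]
      by (simp add: closure_range_radius[OF Rl])
  qed
  then obtain v where v: "\<And>f. v f \<in> ?H2" "\<And>f. norm (v f) \<le> norm (Rr f)"
    "\<And>f g. cinner g ((1/2) *\<^sub>R D f) = cinner (Rl g) (v f)" by metis
  have Rl_v: "Rl (v f) = (1/2) *\<^sub>R D f" for f
    by (rule cinner_right_unique[OF csubspace_UNIV]) (simp_all add: v(3) radius_selfadjoint[OF Rl])
  have "v (x + y) = v x + v y" for x y
    by (rule radius_inj[OF Rl])
      (use v(1) H2 in \<open>simp_all add: csubspace_def Rl_v radius_add[OF Rl] D_lin scaleR_add_right\<close>)
  moreover have "v (c *\<^sub>C x) = c *\<^sub>C v x" for c x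
  proof (rule radius_inj[OF Rl])
    show "v (c *\<^sub>C x) \<in> ?H2" "c *\<^sub>C v x \<in> ?H2"
      using v(1) H2 by (simp_all add: csubspace_def)
    show "Rl (v (c *\<^sub>C x)) = Rl (c *\<^sub>C v x)"
      by (metis Rl_v radius_scaleC[OF Rl] D_lin(2) scaleC_of_real scaleC_scaleC mult.commute)
  qed
  ultimately have v_lin: "clinear_on UNIV v" by (simp add: clinear_on_def)
  have "\<exists>w\<in>?H1. norm w \<le> norm g \<and> (\<forall>f. cinner (v f) g = cinner (Rr f) w)" for g
  proof -
    have "cmod (cinner (v f) g) \<le> norm g * norm (Rr f)" for f
      using order_trans[OF cinner_cauchy_schwarz mult_right_mono[OF v(2) norm_ge_zero]]
      by (simp add: mult.commute)
    then show ?thesis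
      using riesz_through[OF csubspace_UNIV Rr_lin clinear_on_cinner_left[OF v_lin], of g "norm g"]
      by (simp add: closure_range_radius[OF Rr])
  qed
  then obtain w where w: "\<And>g. w g \<in> ?H1" "\<And>g. norm (w g) \<le> norm g"
    "\<And>f g. cinner (v f) g = cinner (Rr f) (w g)" by metis
  \<comment> \<open>Equality in \<open>?H1\<close> may be tested against \<open>range Rr\<close>,
    where the representers \<open>w g\<close> are known.\<close>
  have eqI: "x = y" if "x \<in> ?H1" "y \<in> ?H1" "\<And>f. cinner (Rr f) x = cinner (Rr f) y" for x y
  proof (rule radius_inj[OF Rr that(1,2)])
    show "Rr x = Rr y"
      using radius_orthogonal[OF Rr, of "x - y"] that(3)
      by (simp add: cinner.diff_right radius_diff[OF Rr])
  qed
  have "w (x + y) = w x + w y" for x y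
    by (rule eqI) (use w(1) H1 in \<open>simp_all add: csubspace_def cinner.add_right flip: w(3)\<close>)
  moreover have "w (c *\<^sub>C x) = c *\<^sub>C w x" for c x
    by (rule eqI) (use w(1) H1 in \<open>simp_all add: csubspace_def cinner_scaleC_right flip: w(3)\<close>)
  ultimately have w_lin: "clinear_on UNIV w" by (simp add: clinear_on_def)
  have w_bops: "w \<in> bops ?H2 ?H1"
    using w w_lin by (auto simp: bops_iff clinear_on_def intro!: exI[of _ 1])
  let ?Q = "cadjoint ?H2 ?H1 w"
  note Q = cadjoint_bops[OF H2 closed_orthcomp H1(1) w_bops]
    and Q_cinner = cadjoint_cinner[OF H2 closed_orthcomp H1(1) w_bops]
  have Q_in: "?Q h \<in> ?H2" if "h \<in> ?H1" for h using Q that by (auto simp: bops_iff)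
  have "norm (?Q h) \<le> norm h" if h: "h \<in> ?H1" for h
  proof (cases "?Q h = 0")
    case False
    have "(norm (?Q h))\<^sup>2 = cmod (cinner (?Q h) (?Q h))" by (simp add: cinner_self norm_power)
    also have "\<dots> = cmod (cinner (w (?Q h)) h)" using Q_cinner Q_in h by simp
    also have "\<dots> \<le> norm (?Q h) * norm h"
      using order_trans[OF cinner_cauchy_schwarz mult_right_mono[OF w(2) norm_ge_zero]] .
    finally show ?thesis using False by (simp add: power2_eq_square)
  qed simp
  then have "?Q \<in> contractions ?H1 ?H2"
    using Q by (simp add: contractions_iff[OF H1(1)] bops_iff)
  moreover have "D f = 2 *\<^sub>R Rl (?Q (Rr f))" for f
  proof -
    have "?Q (Rr f) = v f"
    proof (rule cinner_right_unique[OF H2])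
      fix g assume g: "g \<in> ?H2"
      have "cinner g (?Q (Rr f)) = cinner (w g) (Rr f)"
        using Q_cinner g radius_in[OF Rr] by blast
      also have "\<dots> = cnj (cinner (v f) g)"
        by (subst cinner_commute) (simp add: w(3))
      also have "\<dots> = cinner g (v f)" by (rule cinner_commute[symmetric])
      finally show "cinner g (?Q (Rr f)) = cinner g (v f)" .
    qed (use Q_in v(1) radius_in[OF Rr] in auto)
    then show ?thesis by (simp add: Rl_v)
  qed
  ultimately show ?thesis unfolding factors_through_def by blast
qed

lemma factors_through_imp_product_estimate:
  fixes Rl Rr :: "'a::chilbert_space \<Rightarrow> 'a"
  assumes Rl: "nonneg_selfadjoint Rl" and Rr: "nonneg_selfadjoint Rr"
    and F: "factors_through D Rl Rr Q"
  shows "product_estimate D Rl Rr"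
  unfolding product_estimate_def
proof (intro allI)
  fix f g
  have "norm (Q (Rr f)) \<le> norm (Rr f)"
    using F radius_in[OF Rr] by (simp add: factors_through_def contractions_iff csubspace_orthcomp)
  then have "cmod (cinner (Q (Rr f)) (Rl g)) \<le> norm (Rr f) * norm (Rl g)"
    using order_trans[OF cinner_cauchy_schwarz mult_right_mono[OF _ norm_ge_zero]] by blast
  moreover have "cinner (D f) g = 2 * cinner (Q (Rr f)) (Rl g)"
    using F by (simp add: factors_through_def cinner.scaleR_left radius_selfadjoint[OF Rl] scaleR_conv_of_real)
  ultimately show "cmod (cinner (D f) g) \<le> 2 * (norm (Rr f) * norm (Rl g))"
    by (simp add: norm_mult)
qed

text \<open>The quadratic bound equals \<open>norm (Rr f) ^ 2 + norm (Rl g) ^ 2\<close>. One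
  direction is the arithmetic-geometric mean inequality; for the other, \<open>f\<close> is scaled
  by a real \<open>t\<close> and the discriminant gives the optimal estimate.\<close>

lemma quadratic_estimate_iff_product_estimate:
  fixes Rl Rr :: "'a::chilbert_space \<Rightarrow> 'a"
  assumes Rl: "nonneg_selfadjoint Rl" and Rr: "nonneg_selfadjoint Rr"
    and D: "clinear_on UNIV D"
  shows "quadratic_estimate D Rl Rr \<longleftrightarrow> product_estimate D Rl Rr"
proof -
  have quad: "2 * ((1/2) * (Re (cinner (Rr (Rr f)) f) + Re (cinner (Rl (Rl g)) g)))
      = (norm (Rr f))\<^sup>2 + (norm (Rl g))\<^sup>2" for f g
    using radius_selfadjoint[OF Rr, of "Rr f" f] radius_selfadjoint[OF Rl, of "Rl g" g]
    by (simp add: cinner_self)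
  show ?thesis
  proof
    assume est: "product_estimate D Rl Rr"
    have "cmod (cinner (D f) g) \<le> (norm (Rr f))\<^sup>2 + (norm (Rl g))\<^sup>2" for f g
    proof -
      have "cmod (cinner (D f) g) \<le> 2 * (norm (Rr f) * norm (Rl g))"
        using est by (simp add: product_estimate_def)
      also have "\<dots> \<le> (norm (Rr f))\<^sup>2 + (norm (Rl g))\<^sup>2"
        using sum_squares_bound[of "norm (Rr f)" "norm (Rl g)"] by (simp only: mult.assoc)
      finally show ?thesis .
    qed
    then show "quadratic_estimate D Rl Rr" by (simp only: quadratic_estimate_def quad) simp
  next
    assume "quadratic_estimate D Rl Rr"
    then have est: "cmod (cinner (D f) g) \<le> (norm (Rr f))\<^sup>2 + (norm (Rl g))\<^sup>2" for f g
      by (simp only: quadratic_estimate_def quad)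
    have "cmod (cinner (D f) g) \<le> 2 * (norm (Rr f) * norm (Rl g))" for f g
    proof -
      have "0 \<le> (norm (Rl g))\<^sup>2 + 2 * t * (- cmod (cinner (D f) g) / 2) + t\<^sup>2 * (norm (Rr f))\<^sup>2" for t
      proof -
        have "t * cmod (cinner (D f) g) \<le> \<bar>t\<bar> * cmod (cinner (D f) g)"
          by (rule mult_right_mono) auto
        also have "\<dots> \<le> t\<^sup>2 * (norm (Rr f))\<^sup>2 + (norm (Rl g))\<^sup>2"
          using est[of "t *\<^sub>R f" g]
          by (simp add: clinear_on_scaleR[OF D] radius_scaleR[OF Rr] cinner.scaleR_left power_mult_distrib)
        finally show ?thesis by simp
      qed
      then have "(- cmod (cinner (D f) g) / 2)\<^sup>2 \<le> (norm (Rl g))\<^sup>2 * (norm (Rr f))\<^sup>2"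
        by (rule quadratic_nonneg_discriminant) simp
      then have "(cmod (cinner (D f) g) / 2)\<^sup>2 \<le> (norm (Rr f) * norm (Rl g))\<^sup>2"
        by (simp add: power_mult_distrib power_divide mult.commute)
      then have "cmod (cinner (D f) g) / 2 \<le> norm (Rr f) * norm (Rl g)"
        by (rule power2_le_imp_le) simp
      then show ?thesis by simp
    qed
    then show "product_estimate D Rl Rr" by (simp add: product_estimate_def)
  qed
qed

text \<open>A bounded \<open>K\<close> is continuous and \<open>range R\<close> is dense in its
  domain.\<close>

lemma bops_zero_of_range_radius:
  fixes R :: "'a::chilbert_space \<Rightarrow> 'a"
  assumes R: "nonneg_selfadjoint R" and K: "K \<in> bops (orthcomp (kernel R)) N"
    and "\<And>x. K (R x) = 0" and h: "h \<in> orthcomp (kernel R)"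
  shows "K h = 0"
proof (rule continuous_constant_on_closure[of "range R"])
  show "continuous_on (closure (range R)) K"
    unfolding closure_range_radius[OF R] by (rule bops_continuous_on[OF csubspace_orthcomp K])
qed (use assms closure_range_radius[OF R] in auto)

section \<open>Intersections of operator balls\<close>

text \<open>With \<open>u = C1 x\<close> and \<open>v = C2 x\<close> this writes the midpoint of the
  centers as either center shifted by half their difference, which is \<open>Rl (Q (Rr x))\<close>;
  with \<open>u = K2 x\<close> and \<open>v = K1 x\<close> it recovers both contractions from their
  average.\<close>

lemma midpoint_eq:
  fixes u v :: "'a::real_vector"
  shows "(1/2) *\<^sub>R (u + v) = u - (1/2) *\<^sub>R (u - v)"
    and "(1/2) *\<^sub>R (u + v) = v + (1/2) *\<^sub>R (u - v)"
proof -
  have "u - (1/2) *\<^sub>R (u - v) = (1/2) *\<^sub>R ((u + u) - (u - v))"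
    "v + (1/2) *\<^sub>R (u - v) = (1/2) *\<^sub>R ((v + v) + (u - v))"
    by (simp_all only: scaleR_diff_right scaleR_add_right[of _ _ "u - v"] scaleR_half_double)
  then show "(1/2) *\<^sub>R (u + v) = u - (1/2) *\<^sub>R (u - v)"
    "(1/2) *\<^sub>R (u + v) = v + (1/2) *\<^sub>R (u - v)"
    by simp_all
qed

lemma compression_contraction:
  fixes N :: "'a::chilbert_space set"
  assumes "csubspace M" "csubspace N" "closed N" "K \<in> contractions UNIV UNIV"
  shows "(\<lambda>x. proj N (K x)) \<in> contractions M N"
proof -
  have "clinear_on UNIV K" "\<And>x. norm (K x) \<le> norm x"
    using assms(4) by (auto simp: contractions_iff)
  then show ?thesis
    using assms clinear_on_proj[OF assms(2,3), of UNIV] order_trans[OF norm_proj_le[OF assms(2,3)]]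
    by (auto simp: contractions_iff proj_in clinear_on_def)
qed

lemma extension_contraction:
  fixes M :: "'a::chilbert_space set"
  assumes "csubspace M" "closed M" "K \<in> contractions M N"
  shows "(\<lambda>x. K (proj M x)) \<in> contractions UNIV UNIV"
proof -
  have "clinear_on M K" "\<And>x. x \<in> M \<Longrightarrow> norm (K x) \<le> norm x"
    using assms by (auto simp: contractions_iff)
  then show ?thesis
    using assms clinear_on_proj[OF assms(1,2), of UNIV] order_trans[OF _ norm_proj_le[OF assms(1,2)]]
    by (auto simp: contractions_iff proj_in clinear_on_def)
qed

text \<open>Only the compression of \<open>K\<close> enters the product: \<open>Rl\<close> does not
  change when its argument is projected, and the values of \<open>Rr\<close> lie in the complement
  of its kernel. Conversely, a contraction between the complements is extended by composing with the
  projection.\<close>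

lemma operator_ball_iff:
  fixes Rl Rr :: "'a::chilbert_space \<Rightarrow> 'a"
  assumes Rl: "nonneg_selfadjoint Rl" and Rr: "nonneg_selfadjoint Rr"
  shows "T \<in> operator_ball C Rl Rr \<longleftrightarrow>
    (\<exists>K \<in> contractions (orthcomp (kernel Rr)) (orthcomp (kernel Rl)). T = (\<lambda>x. C x + Rl (K (Rr x))))"
proof
  assume "T \<in> operator_ball C Rl Rr"
  then obtain K where K: "K \<in> contractions UNIV UNIV" "T = (\<lambda>x. C x + Rl (K (Rr x)))"
    by (auto simp: operator_ball_def)
  show "\<exists>K \<in> contractions (orthcomp (kernel Rr)) (orthcomp (kernel Rl)). T = (\<lambda>x. C x + Rl (K (Rr x)))"
  proof (rule bexI)
    show "T = (\<lambda>x. C x + Rl (proj (orthcomp (kernel Rl)) (K (Rr x))))"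
      by (simp add: K(2) radius_proj[OF Rl])
  qed (rule compression_contraction[OF csubspace_orthcomp csubspace_orthcomp closed_orthcomp K(1)])
next
  assume "\<exists>K \<in> contractions (orthcomp (kernel Rr)) (orthcomp (kernel Rl)). T = (\<lambda>x. C x + Rl (K (Rr x)))"
  then obtain K where K: "K \<in> contractions (orthcomp (kernel Rr)) (orthcomp (kernel Rl))"
    "T = (\<lambda>x. C x + Rl (K (Rr x)))" by blast
  show "T \<in> operator_ball C Rl Rr"
    unfolding operator_ball_def mem_Collect_eq
  proof (rule bexI)
    show "T = (\<lambda>x. C x + Rl (K (proj (orthcomp (kernel Rr)) (Rr x))))"
      by (simp add: K(2) proj_ident[OF csubspace_orthcomp closed_orthcomp] radius_in[OF Rr])
  qed (rule extension_contraction[OF csubspace_orthcomp closed_orthcomp K(1)])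
qed

text \<open>Subtracting the two representations of \<open>T\<close> gives \<open>C1 - C2\<close> the
  middle factor \<open>K2 - K1\<close>; half of it is a contraction by the triangle
  inequality.\<close>

lemma Int_operator_ball_imp_factors_through:
  fixes Rl Rr :: "'a::chilbert_space \<Rightarrow> 'a"
  assumes Rl: "nonneg_selfadjoint Rl" and Rr: "nonneg_selfadjoint Rr"
    and T: "T \<in> operator_ball C1 Rl Rr \<inter> operator_ball C2 Rl Rr"
  shows "\<exists>Q. factors_through (\<lambda>x. C1 x - C2 x) Rl Rr Q"
proof -
  let ?H1 = "orthcomp (kernel Rr)" and ?H2 = "orthcomp (kernel Rl)"
  obtain K1 K2 where K: "K1 \<in> contractions ?H1 ?H2" "K2 \<in> contractions ?H1 ?H2"
    "T = (\<lambda>x. C1 x + Rl (K1 (Rr x)))" "T = (\<lambda>x. C2 x + Rl (K2 (Rr x)))"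
    using T by (auto simp: operator_ball_iff[OF Rl Rr])
  let ?Q = "\<lambda>x. (1/2) *\<^sub>R (K2 x - K1 x)"
  have Q: "?Q \<in> bops ?H1 ?H2"
    using K(1,2) by (intro bops_scaleR bops_diff csubspace_orthcomp) (simp_all add: contractions_def)
  have "norm (?Q x) \<le> norm x" if "x \<in> ?H1" for x
  proof -
    have "norm (K1 x) \<le> norm x" "norm (K2 x) \<le> norm x"
      using K(1,2) that by (auto simp: contractions_iff[OF csubspace_orthcomp])
    then show ?thesis using norm_triangle_ineq4[of "K2 x" "K1 x"] by simp
  qed
  then have "?Q \<in> contractions ?H1 ?H2"
    using Q by (simp add: contractions_iff[OF csubspace_orthcomp] bops_iff)
  moreover have "C1 x - C2 x = 2 *\<^sub>R Rl (?Q (Rr x))" for x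
    using fun_cong[OF K(3), of x] fun_cong[OF K(4), of x]
    by (simp add: radius_scaleR[OF Rl] radius_diff[OF Rl] algebra_simps)
  ultimately show ?thesis unfolding factors_through_def by blast
qed

lemma Int_operator_ball_iff:
  fixes Rl Rr :: "'a::chilbert_space \<Rightarrow> 'a"
  assumes Rl: "nonneg_selfadjoint Rl" and Rr: "nonneg_selfadjoint Rr"
    and F: "factors_through (\<lambda>x. C1 x - C2 x) Rl Rr Q"
  defines "H1 \<equiv> orthcomp (kernel Rr)" and "H2 \<equiv> orthcomp (kernel Rl)"
  shows "T \<in> operator_ball C1 Rl Rr \<inter> operator_ball C2 Rl Rr \<longleftrightarrow>
    (\<exists>K \<in> bops H1 H2. opnorm H1 (\<lambda>x. K x + Q x) \<le> 1 \<and> opnorm H1 (\<lambda>x. K x - Q x) \<le> 1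
      \<and> T = (\<lambda>x. (1/2) *\<^sub>R (C1 x + C2 x) + Rl (K (Rr x))))" (is "?l \<longleftrightarrow> ?r")
proof
  have H: "csubspace H1" "csubspace H2" by (simp_all add: H1_def H2_def csubspace_orthcomp)
  have Q: "Q \<in> bops H1 H2" and RQ: "Rl (Q (Rr x)) = (1/2) *\<^sub>R (C1 x - C2 x)" for x
    using F by (auto simp: factors_through_def contractions_def H1_def H2_def)
  have RrH: "Rr x \<in> H1" for x using radius_in[OF Rr] by (simp add: H1_def)
  {
    assume ?l
    then obtain K1 K2 where K: "K1 \<in> contractions H1 H2" "K2 \<in> contractions H1 H2"
      "T = (\<lambda>x. C1 x + Rl (K1 (Rr x)))" "T = (\<lambda>x. C2 x + Rl (K2 (Rr x)))"
      by (auto simp: operator_ball_iff[OF Rl Rr] H1_def H2_def)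
    then have Kb: "K1 \<in> bops H1 H2" "K2 \<in> bops H1 H2" by (auto simp: contractions_def)
    let ?K = "\<lambda>x. (1/2) *\<^sub>R (K1 x + K2 x)"
    \<comment> \<open>As \<open>Q\<close> is given in advance, it must be identified with
      \<open>(K2 - K1) / 2\<close>. The discrepancy \<open>?E\<close> is annihilated by
      \<open>Rl\<close> on \<open>range Rr\<close>, vanishes there because \<open>Rl\<close> is
      injective on \<open>H2\<close>, and vanishes on \<open>H1\<close> by density.\<close>
    let ?E = "\<lambda>x. (K2 x - K1 x) - 2 *\<^sub>R Q x"
    have E: "?E \<in> bops H1 H2" by (intro bops_diff bops_scaleR H Kb Q)
    have "?E x = 0" if "x \<in> H1" for x
    proof (rule bops_zero_of_range_radius[OF Rr E[unfolded H1_def]])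
      fix x
      have "Rl (?E (Rr x)) = (Rl (K2 (Rr x)) - Rl (K1 (Rr x))) - (C1 x - C2 x)"
        by (simp add: radius_scaleR[OF Rl] radius_diff[OF Rl] RQ)
      also have "\<dots> = 0"
        using fun_cong[OF K(3), of x] fun_cong[OF K(4), of x] by (simp add: algebra_simps)
      also have "\<dots> = Rl 0"
        by (rule clinear_on_zero[OF csubspace_UNIV radius_clinear[OF Rl], symmetric])
      finally have eq: "Rl (?E (Rr x)) = Rl 0" .
      have "?E (Rr x) \<in> H2" using E RrH by (auto simp: bops_iff)
      moreover have "0 \<in> H2" using H(2) by (simp add: csubspace_def)
      ultimately show "?E (Rr x) = 0"
        unfolding H2_def by (rule radius_inj[OF Rl _ _ eq])
    qed (use that in \<open>simp add: H1_def\<close>)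
    then have Qx: "Q x = (1/2) *\<^sub>R (K2 x - K1 x)" if "x \<in> H1" for x
      using that by simp
    have plus: "?K x + Q x = K2 x" if "x \<in> H1" for x
      by (simp only: Qx[OF that] add.commute[of "K1 x" "K2 x"] midpoint_eq(1) diff_add_cancel)
    have minus: "?K x - Q x = K1 x" if "x \<in> H1" for x
      by (simp only: Qx[OF that] add.commute[of "K1 x" "K2 x"] midpoint_eq(2) add_diff_cancel_right')
    have Kbops: "?K \<in> bops H1 H2" by (intro bops_add bops_scaleR H Kb)
    have "opnorm H1 (\<lambda>x. ?K x + Q x) \<le> 1"
      using K(2) plus by (simp add: bops_opnorm_le_1_iff[OF H(1) bops_add[OF H(2) Kbops Q]] contractions_iff[OF H(1)])
    moreover have "opnorm H1 (\<lambda>x. ?K x - Q x) \<le> 1"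
      using K(1) minus by (simp add: bops_opnorm_le_1_iff[OF H(1) bops_diff[OF H(2) Kbops Q]] contractions_iff[OF H(1)])
    moreover have "T = (\<lambda>x. (1/2) *\<^sub>R (C1 x + C2 x) + Rl (?K (Rr x)))"
    proof
      fix x
      have "T x = (1/2) *\<^sub>R (T x + T x)" by (simp only: scaleR_half_double)
      also have "T x + T x = (C1 x + Rl (K1 (Rr x))) + (C2 x + Rl (K2 (Rr x)))"
        by (rule arg_cong2[where f = "(+)"], rule fun_cong[OF K(3)], rule fun_cong[OF K(4)])
      finally show "T x = (1/2) *\<^sub>R (C1 x + C2 x) + Rl (?K (Rr x))"
        by (simp add: radius_scaleR[OF Rl] radius_add[OF Rl] scaleR_add_right)
    qed
    ultimately show ?r by (intro bexI[OF _ Kbops] conjI)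
  }
  {
    assume ?r
    then obtain K where K: "K \<in> bops H1 H2" "opnorm H1 (\<lambda>x. K x + Q x) \<le> 1"
      "opnorm H1 (\<lambda>x. K x - Q x) \<le> 1" and T: "T = (\<lambda>x. (1/2) *\<^sub>R (C1 x + C2 x) + Rl (K (Rr x)))"
      by blast
    have reorder: "u - h + r = u + (r - h)" "u + h + r = u + (r + h)" for u h r :: 'a
      by (simp_all add: algebra_simps)
    have minus: "(\<lambda>x. K x - Q x) \<in> contractions H1 H2"
      and plus: "(\<lambda>x. K x + Q x) \<in> contractions H1 H2"
      using K bops_diff[OF H(2) K(1) Q] bops_add[OF H(2) K(1) Q] by (auto simp: contractions_def)
    have "T = (\<lambda>x. C1 x + Rl (K (Rr x) - Q (Rr x)))"
      by (simp only: T radius_diff[OF Rl] RQ midpoint_eq(1) reorder)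
    moreover have "T = (\<lambda>x. C2 x + Rl (K (Rr x) + Q (Rr x)))"
      by (simp only: T radius_add[OF Rl] RQ midpoint_eq(2) reorder)
    ultimately show ?l
      unfolding Int_iff operator_ball_iff[OF Rl Rr] H1_def[symmetric] H2_def[symmetric]
      by (intro conjI bexI[OF _ minus] bexI[OF _ plus])
  }
qed

section \<open>Extreme contractions\<close>

text \<open>The hypothesis \<open>extreme\<close> expresses extremality of \<open>Q\<close> in the
  unit ball through symmetric perturbations. If \<open>Q\<close> is neither isometric nor
  coisometric, a nonzero rank-one \<open>K\<close> violates it.\<close>

lemma extreme_contraction_imp_maximal_partial_isometry:
  fixes M :: "'a::chilbert_space set" and N :: "'b::chilbert_space set"
  assumes M: "csubspace M" "closed M" and N: "csubspace N" "closed N"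
    and Q: "Q \<in> contractions M N"
    and extreme: "\<And>K. K \<in> bops M N \<Longrightarrow> opnorm M (\<lambda>x. K x + Q x) \<le> 1 \<Longrightarrow>
      opnorm M (\<lambda>x. K x - Q x) \<le> 1 \<Longrightarrow> \<forall>x\<in>M. K x = 0"
  shows "maximal_partial_isometry M N Q"
proof (rule ccontr)
  have Qb: "Q \<in> bops M N" using Q by (simp add: contractions_def)
  have Q_lin: "clinear_on M Q" and Q_le: "\<And>x. x \<in> M \<Longrightarrow> norm (Q x) \<le> norm x"
    and Q_in: "\<And>x. x \<in> M \<Longrightarrow> Q x \<in> N"
    using Q by (auto simp: contractions_iff[OF M(1)])
  let ?A = "cadjoint M N Q"
  note A_bops = cadjoint_bops[OF M N(1) Qb] and A = cadjoint_cinner[OF M N(1) Qb]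
  have A_in: "?A y \<in> M" if "y \<in> N" for y using A_bops that by (auto simp: bops_iff)
  assume "\<not> maximal_partial_isometry M N Q"
  then obtain x y where x: "x \<in> M" "?A (Q x) \<noteq> x" and y: "y \<in> N" "Q (?A y) \<noteq> y"
    using Qb by (auto simp: maximal_partial_isometry_def)
  define a where "a = x - ?A (Q x)"
  define z where "z = ?A y"
  define c where "c = y - Q z"
  have a: "a \<in> M" "a \<noteq> 0" and z: "z \<in> M" and c: "c \<in> N" "c \<noteq> 0"
    using x y A_in Q_in by (auto simp: a_def z_def c_def intro!: csubspace_diff M(1) N(1))
  \<comment> \<open>On the diagonal this form is the defect
    \<open>norm f ^ 2 - norm (Q f) ^ 2\<close>, the room left for a perturbation at
    \<open>f\<close>.\<close>
  define B where "B f g = cinner f g - cinner (Q f) (Q g)" for f g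
  have B_add: "B (f + f') g = B f g + B f' g" if "f \<in> M" "f' \<in> M" for f f' g
    using that Q_lin by (simp add: B_def clinear_on_def cinner.add_left)
  have B_scale: "B (s *\<^sub>C f) g = s * B f g" if "f \<in> M" for s f g
    using that Q_lin by (simp add: B_def clinear_on_def cinner_scaleC_left right_diff_distrib)
  have B_self: "Re (B f f) = (norm f)\<^sup>2 - (norm (Q f))\<^sup>2" for f
    by (simp add: B_def cinner_self)
  have B_pos: "0 \<le> Re (B f f)" if "f \<in> M" for f
    using Q_le[OF that] by (simp add: B_self power_mono)
  have B_sym: "B g f = cnj (B f g)" for f g
    by (simp only: B_def complex_cnj_diff cinner_commute[symmetric])
  have B_cs: "(cmod (B f g))\<^sup>2 \<le> Re (B f f) * Re (B g g)" if "f \<in> M" "g \<in> M" for f g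
    by (rule psd_form_cauchy_schwarz[OF M(1) B_add B_scale B_sym B_pos that])
  have Bx: "B f x = cinner f a" if "f \<in> M" for f
    using A[OF that Q_in[OF x(1)]] by (simp add: B_def a_def cinner.diff_right)
  \<comment> \<open>Because \<open>z\<close> is the adjoint of \<open>Q\<close> applied to
    \<open>y\<close>, the inner product of \<open>Q f\<close> with \<open>c\<close> is also a value
    of \<open>B\<close>. Both factors of the cross term are thus controlled by
    \<open>B f f\<close>.\<close>
  have Bz: "B f z = cinner (Q f) c" if "f \<in> M" for f
    using A[OF that y(1)] by (simp add: B_def c_def z_def cinner.diff_right)
  \<comment> \<open>The coefficients of \<open>Re (B f f)\<close> are collected here: the first two
    summands come from the cross term, the last from \<open>norm (K f) ^ 2\<close>, where
    \<open>\<epsilon> * \<epsilon> \<le> \<epsilon>\<close> is used. The choice of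
    \<open>\<epsilon>\<close> then ensures \<open>\<epsilon> * \<delta> \<le> 1\<close>.\<close>
  define \<delta> where "\<delta> = Re (B x x) + Re (B z z) + (norm c)\<^sup>2 * Re (B x x)"
  have \<delta>: "0 \<le> \<delta>" using B_pos x(1) z by (simp add: \<delta>_def)
  define \<epsilon> where "\<epsilon> = 1 / (1 + \<delta>)"
  have \<epsilon>: "0 < \<epsilon>" "\<epsilon> \<le> 1" "\<epsilon> * \<delta> \<le> 1" using \<delta> by (simp_all add: \<epsilon>_def field_simps)
  define K where "K f = (of_real \<epsilon> * cinner f a) *\<^sub>C c" for f
  have K_norm: "norm (K f) = \<epsilon> * cmod (cinner f a) * norm c" for f
    using \<epsilon>(1) by (simp add: K_def norm_scaleC norm_mult)
  have "norm (K f) \<le> (\<epsilon> * norm a * norm c) * norm f" for f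
    using mult_right_mono[OF mult_left_mono[OF cinner_cauchy_schwarz[of f a]], of \<epsilon> "norm c"] \<epsilon>(1)
    by (simp add: K_norm mult_ac)
  then have "\<exists>b. \<forall>f\<in>M. norm (K f) \<le> b * norm f" by blast
  then have K: "K \<in> bops M N"
    using c(1) N(1)
    by (auto simp: bops_def csubspace_def K_def cinner.add_left cinner_scaleC_left
        scaleC_scaleC distrib_left mult_ac simp flip: scaleC_add_left)
  \<comment> \<open>The left side dominates the squared norms of \<open>K f + Q f\<close> and
    \<open>K f - Q f\<close> at once.\<close>
  have main: "(norm (K f))\<^sup>2 + 2 * \<bar>Re (cinner (K f) (Q f))\<bar> + (norm (Q f))\<^sup>2 \<le> (norm f)\<^sup>2" if f: "f \<in> M" for f
  proof -
    let ?d = "Re (B f f)"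
    have d: "0 \<le> ?d" using B_pos f .
    have fa: "(cmod (cinner f a))\<^sup>2 \<le> ?d * Re (B x x)"
      using B_cs[OF f x(1)] Bx[OF f] by simp
    have qc: "(cmod (cinner (Q f) c))\<^sup>2 \<le> ?d * Re (B z z)"
      using B_cs[OF f z] Bz[OF f] by simp
    have "cmod (cinner (K f) (Q f)) = \<epsilon> * (cmod (cinner f a) * cmod (cinner (Q f) c))"
      using \<epsilon>(1) cinner_commute[of c "Q f"]
      by (simp add: K_def cinner_scaleC_left norm_mult)
    then have "2 * \<bar>Re (cinner (K f) (Q f))\<bar> \<le> \<epsilon> * (2 * cmod (cinner f a) * cmod (cinner (Q f) c))"
      using abs_Re_le_cmod[of "cinner (K f) (Q f)"] by simp
    also have "\<dots> \<le> \<epsilon> * ((cmod (cinner f a))\<^sup>2 + (cmod (cinner (Q f) c))\<^sup>2)"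
      using \<epsilon>(1) by (intro mult_left_mono sum_squares_bound) auto
    also have "\<dots> \<le> \<epsilon> * (?d * Re (B x x) + ?d * Re (B z z))"
      using \<epsilon>(1) fa qc by (intro mult_left_mono add_mono) auto
    finally have cross: "2 * \<bar>Re (cinner (K f) (Q f))\<bar> \<le> \<epsilon> * (?d * Re (B x x) + ?d * Re (B z z))" .
    have "(norm (K f))\<^sup>2 = (\<epsilon> * \<epsilon>) * ((cmod (cinner f a))\<^sup>2 * (norm c)\<^sup>2)"
      by (simp add: K_norm power_mult_distrib power2_eq_square)
    also have "\<dots> \<le> \<epsilon> * ((cmod (cinner f a))\<^sup>2 * (norm c)\<^sup>2)"
      using \<epsilon> by (intro mult_right_mono) (auto intro: mult_left_le)
    also have "\<dots> \<le> \<epsilon> * ((?d * Re (B x x)) * (norm c)\<^sup>2)"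
      using \<epsilon>(1) fa by (intro mult_left_mono mult_right_mono) auto
    finally have "(norm (K f))\<^sup>2 + 2 * \<bar>Re (cinner (K f) (Q f))\<bar> \<le> ?d * (\<epsilon> * \<delta>)"
      using cross by (simp add: \<delta>_def algebra_simps)
    also have "\<dots> \<le> ?d" using \<epsilon>(3) d by (rule mult_left_le)
    finally show ?thesis by (simp add: B_self)
  qed
  have "norm (K f + Q f) \<le> norm f" "norm (K f - Q f) \<le> norm f" if "f \<in> M" for f
    by (rule power2_le_imp_le; use main[OF that] in \<open>simp add: norm_add_sq norm_diff_sq\<close>)+
  then have "opnorm M (\<lambda>f. K f + Q f) \<le> 1" "opnorm M (\<lambda>f. K f - Q f) \<le> 1"
    by (simp_all add: bops_opnorm_le_1_iff[OF M(1) bops_add[OF N(1) K Qb]]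
        bops_opnorm_le_1_iff[OF M(1) bops_diff[OF N(1) K Qb]])
  \<comment> \<open>Contradiction, as \<open>K a\<close> is \<open>c\<close> times the positive
    number \<open>\<epsilon> * norm a ^ 2\<close>.\<close>
  with extreme[OF K] a(1) have "K a = 0" by blast
  then have "norm (K a) = 0" by simp
  then show False using \<epsilon>(1) a(2) c(2) by (simp add: K_norm cinner_self)
qed

text \<open>For an isometric \<open>Q\<close> the parallelogram law for \<open>K x\<close> and
  \<open>Q x\<close> leaves no room for \<open>K x\<close>. For a coisometric \<open>Q\<close> the
  same argument, run for the adjoints at \<open>y = K x\<close>, gives \<open>?B y = 0\<close>, and
  then \<open>cinner y y = cinner x (?B y)\<close> vanishes.\<close>

lemma maximal_partial_isometry_imp_extreme_contraction:
  fixes M :: "'a::chilbert_space set" and N :: "'b::chilbert_space set"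
  assumes M: "csubspace M" "closed M" and N: "csubspace N" "closed N"
    and Q: "maximal_partial_isometry M N Q"
    and K: "K \<in> bops M N" "opnorm M (\<lambda>x. K x + Q x) \<le> 1" "opnorm M (\<lambda>x. K x - Q x) \<le> 1"
    and x: "x \<in> M"
  shows "K x = 0"
proof -
  have Qb: "Q \<in> bops M N" using Q by (simp add: maximal_partial_isometry_def)
  have le: "norm (K u + Q u) \<le> norm u" "norm (K u - Q u) \<le> norm u" if "u \<in> M" for u
    using K(2,3) that by (simp_all add: bops_opnorm_le_1_iff[OF M(1) bops_add[OF N(1) K(1) Qb]]
        bops_opnorm_le_1_iff[OF M(1) bops_diff[OF N(1) K(1) Qb]])
  let ?A = "cadjoint M N Q" and ?B = "cadjoint M N K"
  note A = cadjoint_cinner[OF M N(1) Qb] and B = cadjoint_cinner[OF M N(1) K(1)]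
  have in_N: "Q u \<in> N" "K u \<in> N" if "u \<in> M" for u using Qb K(1) that by (auto simp: bops_iff)
  have in_M: "?A y \<in> M" "?B y \<in> M" if "y \<in> N" for y
    using cadjoint_bops[OF M N(1) Qb] cadjoint_bops[OF M N(1) K(1)] that by (auto simp: bops_iff)
  have zeroI: "u = 0" if "norm (u + v) \<le> norm w" "norm (u - v) \<le> norm w" "cinner v v = cinner w w"
    for u v :: "'x::complex_inner" and w :: "'y::complex_inner"
  proof -
    have "(norm v)\<^sup>2 = (norm w)\<^sup>2" using that(3) unfolding cinner_self by (simp only: of_real_eq_iff)
    moreover have "(norm (u + v))\<^sup>2 \<le> (norm w)\<^sup>2" "(norm (u - v))\<^sup>2 \<le> (norm w)\<^sup>2"
      using that(1,2) by (simp_all add: power_mono)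
    ultimately have "(norm u)\<^sup>2 \<le> 0" using parallelogram[of u v] by linarith
    then show ?thesis by simp
  qed
  consider (isometry) "\<forall>x\<in>M. ?A (Q x) = x" | (coisometry) "\<forall>y\<in>N. Q (?A y) = y"
    using Q by (auto simp: maximal_partial_isometry_def)
  then show ?thesis
  proof cases
    case isometry
    then have "cinner (Q x) (Q x) = cinner x x" using A[OF x in_N(1)[OF x]] x by simp
    with le[OF x] show ?thesis by (rule zeroI)
  next
    case coisometry
    define y where "y = K x"
    have y: "y \<in> N" using in_N x by (simp add: y_def)
    \<comment> \<open>Applied to \<open>v = ?B y + ?A y\<close> with \<open>w = K v + Q v\<close>,
      and likewise to differences, this carries the bounds for \<open>K + Q\<close> and
      \<open>K - Q\<close> over to the adjoints.\<close>
    have adj_le: "norm v \<le> norm y" if "v \<in> M" "norm w \<le> norm v" "cinner v v = cinner w y" for v w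
    proof (cases "v = 0")
      case False
      have "(norm v)\<^sup>2 = cmod (cinner w y)" unfolding that(3)[symmetric] by (simp add: cinner_self norm_power)
      also have "\<dots> \<le> norm v * norm y"
        using order_trans[OF cinner_cauchy_schwarz mult_right_mono[OF that(2) norm_ge_zero]] .
      finally show ?thesis using False by (simp add: power2_eq_square)
    qed simp
    have p: "?B y + ?A y \<in> M" and m: "?B y - ?A y \<in> M"
      using in_M[OF y] M(1) by (auto simp: csubspace_def csubspace_diff)
    have "norm (?B y + ?A y) \<le> norm y"
      by (rule adj_le[OF p le(1)[OF p]]) (simp only: cinner.add_left[of "K _"] cinner.add_right A[OF p y] B[OF p y])
    moreover have "norm (?B y - ?A y) \<le> norm y"
      by (rule adj_le[OF m le(2)[OF m]]) (simp only: cinner.diff_left[of "K _"] cinner.diff_right A[OF m y] B[OF m y])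
    moreover have "cinner (?A y) (?A y) = cinner y y"
      using A[OF in_M(1)[OF y] y] coisometry y by simp
    ultimately have "?B y = 0" by (rule zeroI)
    then have "cinner y y = 0" using B[OF x y] by (simp add: y_def cinner.zero_right)
    then show ?thesis by (simp add: cinner_self y_def)
  qed
qed

section \<open>Criteria for intersection, parametrization and one-element intersections\<close>

theorem lemma3p3:
  fixes C1 C2 Rl Rr :: "'a::chilbert_space \<Rightarrow> 'a"
  assumes "separable_space (euclidean :: 'a topology)"
    and "C1 \<in> bops UNIV UNIV" and "C2 \<in> bops UNIV UNIV"
    and "nonneg_selfadjoint Rl" and "nonneg_selfadjoint Rr"
  defines "H1 \<equiv> orthcomp (kernel Rr)" and "H2 \<equiv> orthcomp (kernel Rl)"
    and "D \<equiv> (\<lambda>x. C1 x - C2 x)" and "M \<equiv> (\<lambda>x. (1/2) *\<^sub>R (C1 x + C2 x))"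
    and "L \<equiv> operator_ball C1 Rl Rr \<inter> operator_ball C2 Rl Rr"
  shows
    "((L \<noteq> {} \<longleftrightarrow> quadratic_estimate D Rl Rr)
      \<and> (L \<noteq> {} \<longleftrightarrow> product_estimate D Rl Rr)
      \<and> (L \<noteq> {} \<longleftrightarrow> (\<exists>Q. factors_through D Rl Rr Q))
      \<and> (L \<noteq> {} \<longleftrightarrow> (\<exists>Q. quotient0_closure_contraction D Rl Rr Q)))
    \<and> (quadratic_estimate D Rl Rr \<or> product_estimate D Rl Rr \<or> (\<exists>Q. factors_through D Rl Rr Q) \<longrightarrow>
        (\<forall>Q. factors_through D Rl Rr Q \<or> quotient0_closure_contraction D Rl Rr Q \<longrightarrow>
          (\<forall>T. T \<in> L \<longleftrightarrow>
            (\<exists>K \<in> bops H1 H2. opnorm H1 (\<lambda>x. K x + Q x) \<le> 1 \<and> opnorm H1 (\<lambda>x. K x - Q x) \<le> 1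
              \<and> T = (\<lambda>x. M x + Rl (K (Rr x)))))))
    \<and> (L \<noteq> {} \<longrightarrow>
        (\<forall>Q. factors_through D Rl Rr Q \<or> quotient0_closure_contraction D Rl Rr Q \<longrightarrow>
          ((\<exists>T. L = {T}) \<longleftrightarrow> L = {M})
          \<and> (L = {M} \<longleftrightarrow>
              Rl = (\<lambda>_. 0) \<or> Rr = (\<lambda>_. 0) \<or> maximal_partial_isometry H1 H2 Q)))"
proof -
  note Rl = assms(4) and Rr = assms(5)
  have D: "clinear_on UNIV D"
    using bops_diff[OF csubspace_UNIV assms(2,3)] by (simp add: D_def bops_iff)
  have H: "csubspace H1" "closed H1" "csubspace H2" "closed H2"
    by (simp_all add: H1_def H2_def csubspace_orthcomp closed_orthcomp)
  have closure_iff: "quotient0_closure_contraction D Rl Rr Q \<longleftrightarrow> factors_through D Rl Rr Q" for Q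
    using factors_through_iff_closure[OF Rl Rr] by blast
  have param: "T \<in> L \<longleftrightarrow>
      (\<exists>K \<in> bops H1 H2. opnorm H1 (\<lambda>x. K x + Q x) \<le> 1 \<and> opnorm H1 (\<lambda>x. K x - Q x) \<le> 1
        \<and> T = (\<lambda>x. M x + Rl (K (Rr x))))" if "factors_through D Rl Rr Q" for Q T
    using Int_operator_ball_iff[OF Rl Rr that[unfolded D_def]]
    unfolding L_def H1_def H2_def M_def .
  have RlC: "Rl 0 = 0" by (rule clinear_on_zero[OF csubspace_UNIV radius_clinear[OF Rl]])
  \<comment> \<open>The choice \<open>K = 0\<close> is always admissible, since \<open>Q\<close> and
    \<open>-Q\<close> are contractions. Hence a one-element \<open>L\<close> can only be
    \<open>{M}\<close>.\<close>
  have center: "M \<in> L" if F: "factors_through D Rl Rr Q" for Q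
  proof -
    have Q: "Q \<in> contractions H1 H2" using F by (simp add: factors_through_def H1_def H2_def)
    have zero: "(\<lambda>_. 0) \<in> bops H1 H2"
      using bops_scaleR[OF H(3), of Q H1 0] Q by (simp add: contractions_def)
    have "opnorm H1 (\<lambda>x. 0 + Q x) \<le> 1" "opnorm H1 (\<lambda>x. 0 - Q x) \<le> 1"
      using Q by (simp_all add: contractions_def opnorm_def)
    then show ?thesis
      unfolding param[OF F] by (intro bexI[OF _ zero]) (simp add: RlC)
  qed
  have factors: "L \<noteq> {} \<longleftrightarrow> (\<exists>Q. factors_through D Rl Rr Q)"
    using Int_operator_ball_imp_factors_through[OF Rl Rr, of _ C1 C2] center
    unfolding L_def D_def by blast
  have product: "product_estimate D Rl Rr \<longleftrightarrow> (\<exists>Q. factors_through D Rl Rr Q)"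
    using product_estimate_imp_factors_through[OF Rl Rr D]
      factors_through_imp_product_estimate[OF Rl Rr] by blast
  have singleton: "L = {M} \<longleftrightarrow> Rl = (\<lambda>_. 0) \<or> Rr = (\<lambda>_. 0) \<or> maximal_partial_isometry H1 H2 Q"
    if F: "factors_through D Rl Rr Q" for Q
  proof
    assume L: "L = {M}"
    \<comment> \<open>An admissible \<open>K\<close> gives a point of \<open>L\<close>, so
      \<open>Rl (K (Rr x)) = 0\<close>. Injectivity of \<open>Rl\<close> on \<open>H2\<close> and
      density of \<open>range Rr\<close> in \<open>H1\<close> turn this into \<open>K = 0\<close> on
      \<open>H1\<close>, which is extremality of \<open>Q\<close>.\<close>
    have "maximal_partial_isometry H1 H2 Q"
    proof (rule extreme_contraction_imp_maximal_partial_isometry[OF H])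
      show "Q \<in> contractions H1 H2" using F by (simp add: factors_through_def H1_def H2_def)
      fix K assume K: "K \<in> bops H1 H2" "opnorm H1 (\<lambda>x. K x + Q x) \<le> 1" "opnorm H1 (\<lambda>x. K x - Q x) \<le> 1"
      then have "(\<lambda>x. M x + Rl (K (Rr x))) \<in> L" unfolding param[OF F] by blast
      then have "(\<lambda>x. M x + Rl (K (Rr x))) = M" using L by simp
      then have eq: "Rl (K (Rr x)) = Rl 0" for x by (simp add: RlC fun_eq_iff)
      have KR: "K (Rr x) = 0" for x
      proof (rule radius_inj[OF Rl _ _ eq])
        show "K (Rr x) \<in> orthcomp (kernel Rl)"
          using K(1) radius_in[OF Rr] by (auto simp: bops_iff H1_def H2_def)
        show "0 \<in> orthcomp (kernel Rl)"
          using H(3) by (simp add: csubspace_def H2_def)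
      qed
      show "\<forall>x\<in>H1. K x = 0"
        using bops_zero_of_range_radius[OF Rr K(1)[unfolded H1_def] KR] by (simp add: H1_def)
    qed
    then show "Rl = (\<lambda>_. 0) \<or> Rr = (\<lambda>_. 0) \<or> maximal_partial_isometry H1 H2 Q" by blast
  next
    assume cases: "Rl = (\<lambda>_. 0) \<or> Rr = (\<lambda>_. 0) \<or> maximal_partial_isometry H1 H2 Q"
    have "T = M" if "T \<in> L" for T
    proof -
      obtain K where K: "K \<in> bops H1 H2" "opnorm H1 (\<lambda>x. K x + Q x) \<le> 1"
        "opnorm H1 (\<lambda>x. K x - Q x) \<le> 1" and T: "T = (\<lambda>x. M x + Rl (K (Rr x)))"
        using \<open>T \<in> L\<close> unfolding param[OF F] by blast
      have "Rl (K (Rr x)) = 0" for x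
        using cases
      proof (elim disjE)
        assume "Rr = (\<lambda>_. 0)"
        moreover have "K 0 = 0"
          by (rule clinear_on_zero[OF H(1)]) (use K(1) in \<open>simp add: bops_iff\<close>)
        ultimately show ?thesis by (simp add: RlC)
      next
        assume "maximal_partial_isometry H1 H2 Q"
        from maximal_partial_isometry_imp_extreme_contraction[OF H this K, of "Rr x"]
        show ?thesis using radius_in[OF Rr] by (simp add: RlC H1_def)
      qed simp
      then show ?thesis by (simp add: T)
    qed
    with center[OF F] show "L = {M}" by blast
  qed
  have unique: "(\<exists>T. L = {T}) \<longleftrightarrow> L = {M}" if "factors_through D Rl Rr Q" for Q
    using center[OF that] by blast
  show ?thesis
    unfolding quadratic_estimate_iff_product_estimate[OF Rl Rr D] product closure_iff factors
    using param singleton unique by blast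
qed

end
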